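(* For any positive integer $m$, there are only finitely many strongly $s$-regular ternary $\mathbb{Z}$-lattices $L$, up to isometry, with $m_s(L)=m$.
   Context: A ternary $\mathbb{Z}$-lattice is a positive definite $\mathbb{Z}$-lattice $L$ of rank $3$ on a quadratic space over $\mathbb{Q}$ with quadratic map $Q$ and bilinear form $B$, assumed non-classic integral: the ideal generated by $Q(L)$ is $\mathbb{Z}$. $dL$ is the determinant of a Gram matrix; $4dL\in\mathbb{Z}$; for odd $p$, "$p$ divides $dL$" means $p\mid 4dL$ and $\left(\frac{\pm dL}{p}\right):=\left(\frac{\pm4dL}{p}\right)$. $r(n,L)=\#\{x\in L:Q(x)=n\}$, $m_s(L)=\min\{n\in\mathbb{Z}_{>0}:r(n^2,L)\ne0\}$. Let $S$ be the set of $2$ and the odd primes dividing $4dL$. $L$ is strongly $s$-regular if it represents the square of some positive integer and for every positive integer $n=n_1n_2$ (prime factors of $n_1$ in $S$, $n_2$ coprime to all primes of $S$), $r(n_1^2n_2^2,L)=r(n_1^2,L)\prod_{p\notin S}h_p(dL,\mathrm{ord}_p(n))$ with $h_p(dL,\lambda)=\frac{p^{\lambda+1}-1}{p-1}-\left(\frac{-dL}{p}\right)\frac{p^{\lambda}-1}{p-1}$. *)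

theory Defs
  imports "HOL-Analysis.Analysis" "HOL-Number_Theory.Number_Theory"
begin

text \<open>
  A ternary lattice is a \<open>\<int>\<close>-lattice of full rank in a 3-dimensional quadratic space over
  \<open>\<rat>\<close>. Choosing coordinates, the space is \<open>\<rat>^3\<close> with an arbitrary bilinear form, which is
  part of the data. The normalisation is \<open>Q(x) = B(x,x)\<close>.
\<close>

record zlattice =
  lat :: "(rat^3) set"
  bform :: "rat^3 \<Rightarrow> rat^3 \<Rightarrow> rat"

definition qform :: "zlattice \<Rightarrow> rat^3 \<Rightarrow> rat" where
  "qform L x = bform L x x"

definition symmetric_bilinear :: "(rat^3 \<Rightarrow> rat^3 \<Rightarrow> rat) \<Rightarrow> bool" where
  "symmetric_bilinear B \<longleftrightarrow>
     (\<forall>x y. B x y = B y x) \<and> (\<forall>x. Vector_Spaces.linear (*s) (*) (B x))"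

definition lattice_basis :: "(3 \<Rightarrow> rat^3) \<Rightarrow> (rat^3) set \<Rightarrow> bool" where
  "lattice_basis b L \<longleftrightarrow>
     inj b \<and> vec.independent (range b) \<and> vec.span (range b) = UNIV \<and>
     L = {\<Sum>i\<in>UNIV. of_int (c i) *s b i | c :: 3 \<Rightarrow> int. True}"

global_interpretation rat_int: Modules.module "\<lambda>(k::int) (x::rat). of_int k * x"
  by unfold_locales (simp_all add: algebra_simps)

text \<open>
  The last condition is non-classic integrality with norm ideal \<open>\<int>\<close>: the fractional ideal
  (that is, the \<open>\<int>\<close>-submodule of \<open>\<rat>\<close>) generated by \<open>Q(L)\<close> equals \<open>\<int>\<close>.
\<close>

definition ternary_lattice :: "zlattice \<Rightarrow> bool" where
  "ternary_lattice L \<longleftrightarrow>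
     symmetric_bilinear (bform L) \<and>
     (\<forall>x. x \<noteq> 0 \<longrightarrow> qform L x > 0) \<and>
     (\<exists>b. lattice_basis b (lat L)) \<and>
     rat_int.span (qform L ` lat L) = \<int>"

definition lattice_isometry :: "zlattice \<Rightarrow> zlattice \<Rightarrow> (rat^3 \<Rightarrow> rat^3) \<Rightarrow> bool" where
  "lattice_isometry L M \<sigma> \<longleftrightarrow>
     Vector_Spaces.linear (*s) (*s) \<sigma> \<and> bij \<sigma> \<and>
     (\<forall>x y. bform M (\<sigma> x) (\<sigma> y) = bform L x y) \<and> \<sigma> ` lat L = lat M"

definition isometry_rel :: "(zlattice \<times> zlattice) set" where
  "isometry_rel = {(L, M). ternary_lattice L \<and> ternary_lattice M \<and> (\<exists>\<sigma>. lattice_isometry L M \<sigma>)}"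

definition gram :: "zlattice \<Rightarrow> (3 \<Rightarrow> rat^3) \<Rightarrow> rat^3^3" where
  "gram L b = (\<chi> i j. bform L (b i) (b j))"

text \<open>Independent of the chosen basis, see \<open>det_gram_eq\<close> and \<open>disc_eq\<close> below.\<close>

definition disc :: "zlattice \<Rightarrow> rat" where
  "disc L = det (gram L (SOME b. lattice_basis b (lat L)))"

text \<open>The integer \<open>4dL\<close>; the floor only serves to change the type, see \<open>disc4_eq\<close> below.\<close>

definition disc4 :: "zlattice \<Rightarrow> int" where
  "disc4 L = \<lfloor>4 * disc L\<rfloor>"

definition rep_num :: "nat \<Rightarrow> zlattice \<Rightarrow> nat" where
  "rep_num n L = card {x \<in> lat L. qform L x = of_nat n}"

definition m_s :: "zlattice \<Rightarrow> nat" where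
  "m_s L = (LEAST n. n > 0 \<and> rep_num (n\<^sup>2) L \<noteq> 0)"

definition bad_primes :: "zlattice \<Rightarrow> nat set" where
  "bad_primes L = insert 2 {p. prime p \<and> odd p \<and> int p dvd disc4 L}"

text \<open>
  By convention \<open>(-dL/p) = (-4dL/p)\<close> for odd \<open>p\<close>. Both divisions by \<open>p - 1\<close> are exact.
\<close>

definition h_factor :: "zlattice \<Rightarrow> nat \<Rightarrow> nat \<Rightarrow> int" where
  "h_factor L p l =
     (int p ^ (l + 1) - 1) div (int p - 1)
     - Legendre (- disc4 L) (int p) * ((int p ^ l - 1) div (int p - 1))"

text \<open>
  The product over all primes outside \<open>bad_primes L\<close> is taken over the finitely many of them that
  divide \<open>n\<close>; the remaining factors are \<open>h_factor L p 0 = 1\<close>, see \<open>h_factor_0\<close> below.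
\<close>

definition strongly_s_regular :: "zlattice \<Rightarrow> bool" where
  "strongly_s_regular L \<longleftrightarrow>
     (\<exists>n>0. rep_num (n\<^sup>2) L \<noteq> 0) \<and>
     (\<forall>n n1 n2. n > 0 \<and> n = n1 * n2 \<and> prime_factors n1 \<subseteq> bad_primes L \<and>
        (\<forall>p\<in>bad_primes L. coprime n2 p) \<longrightarrow>
        int (rep_num (n1\<^sup>2 * n2\<^sup>2) L) =
          int (rep_num (n1\<^sup>2) L) *
          (\<Prod>p\<in>{p. prime p \<and> p \<notin> bad_primes L \<and> p dvd n}. h_factor L p (multiplicity p n)))"


lemma h_factor_0: "prime p \<Longrightarrow> h_factor L p 0 = 1"
  using prime_gt_1_nat[of p] by (simp add: h_factor_def)

lemma lattice_isometry_inv: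
  assumes "lattice_isometry L M \<sigma>"
  shows "lattice_isometry M L (inv_into UNIV \<sigma>)"
proof -
  have lin: "Vector_Spaces.linear (*s) (*s) \<sigma>" and bij: "bij \<sigma>"
    and B: "\<And>x y. bform M (\<sigma> x) (\<sigma> y) = bform L x y" and im: "\<sigma> ` lat L = lat M"
    using assms by (auto simp: lattice_isometry_def)
  have "Vector_Spaces.linear (*s) (*s) (inv_into UNIV \<sigma>)"
    using vec.inj_linear_imp_inv_linear[OF lin bij_is_inj[OF bij]] .
  moreover have "bform L (inv_into UNIV \<sigma> x) (inv_into UNIV \<sigma> y) = bform M x y" for x y
    using B[of "inv_into UNIV \<sigma> x" "inv_into UNIV \<sigma> y"] bij by (simp add: bij_is_surj surj_f_inv_f)
  moreover have "inv_into UNIV \<sigma> ` lat M = lat L"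
    using bij im by (metis bij_is_inj image_inv_f_f)
  ultimately show ?thesis
    using bij by (auto simp: lattice_isometry_def bij_imp_bij_inv)
qed

lemma lattice_isometry_compose:
  assumes "lattice_isometry L M \<sigma>" "lattice_isometry M N \<tau>"
  shows "lattice_isometry L N (\<tau> \<circ> \<sigma>)"
  unfolding lattice_isometry_def
proof (intro conjI allI)
  show "Vector_Spaces.linear (*s) (*s) (\<tau> \<circ> \<sigma>)"
    using assms by (auto simp: lattice_isometry_def intro: Vector_Spaces.linear_compose)
  show "bij (\<tau> \<circ> \<sigma>)"
    using assms by (auto simp: lattice_isometry_def intro: bij_comp)
  show "bform N ((\<tau> \<circ> \<sigma>) x) ((\<tau> \<circ> \<sigma>) y) = bform L x y" for x y
    using assms by (simp add: lattice_isometry_def)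
  show "(\<tau> \<circ> \<sigma>) ` lat L = lat N"
    using assms by (metis image_comp lattice_isometry_def)
qed

lemma equiv_isometry_rel: "equiv {L. ternary_lattice L} isometry_rel"
proof (rule equivI)
  show "isometry_rel \<subseteq> {L. ternary_lattice L} \<times> {L. ternary_lattice L}"
    by (auto simp: isometry_rel_def)
  show "refl_on {L. ternary_lattice L} isometry_rel"
    by (auto simp: refl_on_def isometry_rel_def lattice_isometry_def vec.linear_id
             intro!: exI[of _ id])
  show "sym isometry_rel"
    by (auto simp: sym_def isometry_rel_def intro: lattice_isometry_inv)
  show "trans isometry_rel"
    by (auto simp: trans_def isometry_rel_def intro: lattice_isometry_compose)
qed

lemma symmetric_bilinearD:
  assumes "symmetric_bilinear B"
  shows "B x y = B y x" "B x (y + z) = B x y + B x z" "B (x + y) z = B x z + B y z"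
    "B x (c *s y) = c * B x y" "B (c *s x) y = c * B x y"
    "B x (\<Sum>i\<in>I. f i) = (\<Sum>i\<in>I. B x (f i))" "B (\<Sum>i\<in>I. f i) x = (\<Sum>i\<in>I. B (f i) x)"
proof -
  have sym: "B x y = B y x" for x y
    using assms by (auto simp: symmetric_bilinear_def)
  have add: "B x (y + z) = B x y + B x z" and sc: "B x (c *s y) = c * B x y" for x y z c
    using assms by (auto simp: symmetric_bilinear_def Vector_Spaces.linear_iff)
  have "B x 0 = 0" for x
    using sc[of x 0 0] by simp
  then have sm: "B x (\<Sum>i\<in>I. f i) = (\<Sum>i\<in>I. B x (f i))" for x and f :: "'a \<Rightarrow> _" and I
    by (induction I rule: infinite_finite_induct) (auto simp: add)
  show "B x y = B y x" "B x (y + z) = B x y + B x z" "B (x + y) z = B x z + B y z"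
    "B x (c *s y) = c * B x y" "B (c *s x) y = c * B x y"
    "B x (\<Sum>i\<in>I. f i) = (\<Sum>i\<in>I. B x (f i))"
    using sym add sc sm by metis+
  show "B (\<Sum>i\<in>I. f i) x = (\<Sum>i\<in>I. B (f i) x)"
    using sym sm[of x f I] by simp
qed

lemma lattice_basis_mem:
  assumes "lattice_basis b L"
  shows "b i \<in> L"
proof -
  have L: "L = {\<Sum>i\<in>UNIV. of_int (c i) *s b i | c :: 3 \<Rightarrow> int. True}"
    using assms by (simp only: lattice_basis_def)
  have "of_int (if j = i then 1 else 0) *s b j = (if j = i then b j else 0)" for j
    by simp
  then have "b i = (\<Sum>j\<in>UNIV. of_int (if j = i then 1 else 0) *s b j)"
    by simp
  then show ?thesis
    unfolding L by (intro CollectI exI[of _ "\<lambda>j. if j = i then 1 else 0"] conjI TrueI)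
qed

lemma lattice_basis_change:
  assumes "lattice_basis b L" "lattice_basis b' L"
  obtains C :: "rat^3^3" where "\<And>i j. C $ i $ j \<in> \<int>" "\<And>i. b i = (\<Sum>j\<in>UNIV. C $ i $ j *s b' j)"
proof -
  have L: "L = {\<Sum>i\<in>UNIV. of_int (c i) *s b' i | c :: 3 \<Rightarrow> int. True}"
    using assms(2) by (simp only: lattice_basis_def)
  have "\<forall>i. \<exists>c. b i = (\<Sum>j\<in>UNIV. of_int (c j :: int) *s b' j)"
    using lattice_basis_mem[OF assms(1)] unfolding L by auto
  then obtain c where c: "\<And>i. b i = (\<Sum>j\<in>UNIV. of_int (c i j :: int) *s b' j)"
    by metis
  show ?thesis
    by (rule that[of "\<chi> i j. of_int (c i j)"]) (use c in auto)
qed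

lemma lattice_basis_det_nonzero:
  assumes "lattice_basis b L"
  shows "det (\<chi> i. b i) \<noteq> 0"
proof -
  have "rows (\<chi> i. b i) = range b"
    by (auto simp: rows_def row_def vec_lambda_eta)
  then have "vec.span (rows (\<chi> i. b i)) = UNIV"
    using assms by (simp add: lattice_basis_def)
  then have "invertible (\<chi> i. b i)"
    unfolding invertible_left_inverse matrix_left_invertible_span_rows_gen .
  then show ?thesis
    by (simp add: invertible_det_nz)
qed

lemma det_Ints:
  fixes C :: "rat^3^3"
  assumes "\<And>i j. C $ i $ j \<in> \<int>"
  shows "det C \<in> \<int>"
  unfolding det_3 by (intro Ints_add Ints_diff Ints_mult assms)

lemma det_gram_eq:
  assumes B: "symmetric_bilinear (bform L)"
    and b: "lattice_basis b (lat L)" and b': "lattice_basis b' (lat L)"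
  shows "det (gram L b) = det (gram L b')"
proof -
  obtain C :: "rat^3^3" where C: "\<And>i j. C $ i $ j \<in> \<int>"
    "\<And>i. b i = (\<Sum>j\<in>UNIV. C $ i $ j *s b' j)"
    using lattice_basis_change[OF b b'] by blast
  obtain D :: "rat^3^3" where D: "\<And>i j. D $ i $ j \<in> \<int>"
    "\<And>i. b' i = (\<Sum>j\<in>UNIV. D $ i $ j *s b j)"
    using lattice_basis_change[OF b' b] by blast
  have 1: "(\<chi> i. b i) = C ** (\<chi> i. b' i)"
    by (simp add: vec_eq_iff matrix_matrix_mult_def C(2))
  have 2: "(\<chi> i. b' i) = D ** (\<chi> i. b i)"
    by (simp add: vec_eq_iff matrix_matrix_mult_def D(2))
  have "det (\<chi> i. b i) = (det C * det D) * det (\<chi> i. b i)"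
    using arg_cong[OF 1, of det] arg_cong[OF 2, of det] unfolding det_mul by (metis mult.assoc)
  then have CD: "det C * det D = 1"
    using lattice_basis_det_nonzero[OF b] mult_cancel_right1 by blast
  obtain u v :: int where uv: "det C = of_int u" "det D = of_int v"
    using det_Ints[OF C(1)] det_Ints[OF D(1)] by (metis Ints_cases)
  have "u * v = 1"
    using CD uv by (metis of_int_eq_1_iff of_int_mult)
  then have "u = 1 \<or> u = -1"
    using zmult_eq_1_iff by blast
  then have sq: "det C * det C = 1"
    using uv by auto
  have "gram L b $ i $ j = (C ** gram L b' ** transpose C) $ i $ j" for i j
  proof -
    have "gram L b $ i $ j =
        (\<Sum>l\<in>UNIV. \<Sum>k\<in>UNIV. C $ i $ k * bform L (b' k) (b' l) * C $ j $ l)"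
      by (simp add: gram_def C(2) symmetric_bilinearD(4-)[OF B] sum_distrib_left mult_ac)
    also have "\<dots> = (C ** gram L b' ** transpose C) $ i $ j"
      by (simp add: gram_def matrix_matrix_mult_def transpose_def sum_distrib_right)
    finally show ?thesis .
  qed
  then have "gram L b = C ** gram L b' ** transpose C"
    by (simp add: vec_eq_iff)
  then show ?thesis
    using sq by (simp add: det_mul)
qed

lemma disc_eq:
  assumes "ternary_lattice L" "lattice_basis b (lat L)"
  shows "disc L = det (gram L b)"
  unfolding disc_def
proof (rule det_gram_eq)
  show "symmetric_bilinear (bform L)"
    using assms(1) by (simp add: ternary_lattice_def)
  show "lattice_basis (SOME b. lattice_basis b (lat L)) (lat L)"
    by (rule someI[of "\<lambda>b. lattice_basis b (lat L)", OF assms(2)])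
qed (rule assms(2))

lemma disc4_eq:
  assumes L: "ternary_lattice L"
  shows "of_int (disc4 L) = 4 * disc L"
proof -
  note B = symmetric_bilinearD[of "bform L"]
  have sb: "symmetric_bilinear (bform L)"
    using L by (simp add: ternary_lattice_def)
  obtain b where b: "lattice_basis b (lat L)"
    using L by (auto simp: ternary_lattice_def)
  have Q: "qform L x \<in> \<int>" if "x \<in> lat L" for x
    using L that rat_int.span_base[of "qform L x" "qform L ` lat L"]
    by (auto simp: ternary_lattice_def)
  have lat: "lat L = {\<Sum>i\<in>UNIV. of_int (c i) *s b i | c :: 3 \<Rightarrow> int. True}"
    using b by (simp only: lattice_basis_def)
  have plus: "x + y \<in> lat L" if x: "x \<in> lat L" and y: "y \<in> lat L" for x y
  proof -
    obtain c :: "3 \<Rightarrow> int" where c: "x = (\<Sum>i\<in>UNIV. of_int (c i) *s b i)"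
      using x unfolding lat by auto
    obtain d :: "3 \<Rightarrow> int" where d: "y = (\<Sum>i\<in>UNIV. of_int (d i) *s b i)"
      using y unfolding lat by auto
    have "x + y = (\<Sum>i\<in>UNIV. of_int (c i + d i) *s b i)"
      by (simp add: c d sum.distrib vec.scale_left_distrib)
    then show ?thesis
      unfolding lat by (intro CollectI exI[of _ "\<lambda>i. c i + d i"]) simp
  qed
  define g where "g i j = bform L (b i) (b j)" for i j
  have gQ: "g i i \<in> \<int>" for i
    using Q[OF lattice_basis_mem[OF b, of i]] by (simp add: g_def qform_def)
  have gs: "g i j = g j i" for i j
    using B(1)[OF sb] by (simp add: g_def)
  have g2: "2 * g i j \<in> \<int>" for i j
  proof -
    have "qform L (b i + b j) = g i i + g j j + 2 * g i j"
      using B(1)[OF sb, of "b i" "b j"] by (simp add: qform_def g_def B(2,3)[OF sb])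
    then have "2 * g i j = qform L (b i + b j) - g i i - g j j"
      by simp
    moreover have "qform L (b i + b j) \<in> \<int>"
      by (intro Q plus lattice_basis_mem[OF b])
    ultimately show ?thesis
      using gQ by (simp add: Ints_diff)
  qed
  have "det (gram L b) = g 1 1 * g 2 2 * g 3 3 + g 1 2 * g 2 3 * g 3 1 + g 1 3 * g 2 1 * g 3 2
      - g 1 1 * g 2 3 * g 3 2 - g 1 2 * g 2 1 * g 3 3 - g 1 3 * g 2 2 * g 3 1"
    unfolding det_3 gram_def g_def by simp
  then have "4 * disc L = 4 * (g 1 1 * g 2 2 * g 3 3) + (2 * g 1 2) * (2 * g 2 3) * (2 * g 1 3)
      - g 1 1 * (2 * g 2 3) * (2 * g 2 3) - g 2 2 * (2 * g 1 3) * (2 * g 1 3)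
      - g 3 3 * (2 * g 1 2) * (2 * g 1 2)"
    unfolding disc_eq[OF L b] gs[of 2 1] gs[of 3 1] gs[of 3 2] by (simp add: algebra_simps)
  also have "\<dots> \<in> \<int>"
    by (intro Ints_add Ints_diff Ints_mult gQ g2 Ints_numeral)
  finally show ?thesis
    unfolding disc4_def by (metis Ints_cases floor_of_int)
qed

end

theory Submission
  imports Defs "HOL-Computational_Algebra.Squarefree" "HOL-Library.Discrete_Functions"
begin

text \<open>
  Let \<open>m = m_s L\<close>. Minimality of \<open>m\<close> forces every prime factor of \<open>m\<close> to be bad, so strong
  \<open>s\<close>-regularity gives \<open>r(m\<^sup>2p\<^sup>2, L) \<ge> 2p\<close> for every good prime \<open>p\<close>. If the vectors
  with \<open>Q = m\<^sup>2p\<^sup>2\<close> spanned at most a plane, they would be points on a circle of radius \<open>mp\<close>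
  with pairwise integral squared distances; such a circle of radius \<open>R\<close> carries only
  \<open>O(R\<^bsup>2/3\<^esup>)\<close> points (Jarnik), which is impossible once \<open>p > 2197 m\<^sup>2\<close>. Hence \<open>L\<close>
  contains three independent vectors with \<open>Q = m\<^sup>2p\<^sup>2\<close>, and \<open>|4dL| \<le> 24 (m\<^sup>2p\<^sup>2)\<^sup>3\<close>. So all primes
  \<open>p\<close> with \<open>p > 2197 m\<^sup>2\<close> and \<open>24 m\<^sup>6p\<^sup>6 < |4dL|\<close> divide \<open>4dL\<close>, and there are too many of them unless
  some good \<open>p\<close> is bounded in terms of \<open>m\<close>. Then \<open>L\<close> has three independent vectors of bounded
  length; their Gram matrix has finitely many possible values, and \<open>L\<close> is one of finitely many lattices
  between their span and a fixed multiple \<open>1/E\<close> of it.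
\<close>

section \<open>Points with integral squared distances on a circle\<close>

text \<open>
  Circumradius formula: the product of the squared sides is \<open>4R\<^sup>2\<close> times the square of twice the area.
\<close>

lemma circle_chord_identity:
  fixes u v w :: complex
  assumes "norm u = R" "norm v = R" "norm w = R"
  defines "a \<equiv> (norm (u - v))\<^sup>2" and "b \<equiv> (norm (v - w))\<^sup>2" and "c \<equiv> (norm (u - w))\<^sup>2"
  shows "a * b * c = R\<^sup>2 * (4 * a * b - (a + b - c)\<^sup>2)"
proof -
  define x y z where "x = Re u * Re v + Im u * Im v" and "y = Re v * Re w + Im v * Im w"
    and "z = Re u * Re w + Im u * Im w"
  define N where "N = R\<^sup>2"
  have N: "(Re u)\<^sup>2 + (Im u)\<^sup>2 = N" "(Re v)\<^sup>2 + (Im v)\<^sup>2 = N" "(Re w)\<^sup>2 + (Im w)\<^sup>2 = N"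
    using assms(1-3) cmod_power2 unfolding N_def by metis+
  have a: "a = 2 * (N - x)" and b: "b = 2 * (N - y)" and c: "c = 2 * (N - z)"
    using N unfolding a_def b_def c_def cmod_power2 x_def y_def z_def
    by (simp_all add: power2_eq_square algebra_simps)
  \<comment> \<open>The left side is the Gram determinant of three vectors of squared length
    \<open>N\<close>; it vanishes because they lie in a plane.\<close>
  have gram: "N ^ 3 + 2 * x * y * z - N * (x\<^sup>2 + y\<^sup>2 + z\<^sup>2) = 0"
  proof -
    have "(a\<^sup>2 + b\<^sup>2) * (c\<^sup>2 + d\<^sup>2) * (e\<^sup>2 + f\<^sup>2)
        + 2 * (a * c + b * d) * (c * e + d * f) * (a * e + b * f) - (a\<^sup>2 + b\<^sup>2) * (c * e + d * f)\<^sup>2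
        - (c\<^sup>2 + d\<^sup>2) * (a * e + b * f)\<^sup>2 - (e\<^sup>2 + f\<^sup>2) * (a * c + b * d)\<^sup>2 = 0"
      for a b c d e f :: real
      by (simp add: power2_eq_square algebra_simps)
    from this[of "Re u" "Im u" "Re v" "Im v" "Re w" "Im w"] show ?thesis
      unfolding N x_def[symmetric] y_def[symmetric] z_def[symmetric]
      by (simp add: algebra_simps power3_eq_cube)
  qed
  have "a * b * c - N * (4 * a * b - (a + b - c)\<^sup>2) 
      = - 4 * (N ^ 3 + 2 * x * y * z - N * (x\<^sup>2 + y\<^sup>2 + z\<^sup>2))"
    unfolding a b c by (simp add: power2_eq_square power3_eq_cube algebra_simps)
  then show ?thesis
    using gram by (simp add: N_def)
qed

text \<open>Three points in one box are wanted, not two, since the circumradius formula is applied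
  to a triangle.\<close>

lemma pigeonhole_three:
  assumes "finite Z" "card Z > 2 * n" "\<And>z. z \<in> Z \<Longrightarrow> g z < (n::nat)"
  obtains u v w where "u \<in> Z" "v \<in> Z" "w \<in> Z" "u \<noteq> v" "v \<noteq> w" "u \<noteq> w" "g u = g v" "g v = g w"
proof -
  have "\<exists>j<n. card {z \<in> Z. g z = j} \<ge> 3"
  proof (rule ccontr)
    assume "\<not> ?thesis"
    then have le: "card {z \<in> Z. g z = j} \<le> 2" if "j < n" for j
      using that by force
    have "Z = (\<Union>j\<in>{..<n}. {z \<in> Z. g z = j})"
      using assms(3) by auto
    then have "card Z \<le> (\<Sum>j<n. card {z \<in> Z. g z = j})"
      using card_UN_le[of "{..<n}" "\<lambda>j. {z \<in> Z. g z = j}"] by simp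
    also have "\<dots> \<le> (\<Sum>j<n. 2)"
      by (intro sum_mono le) auto
    finally show False
      using assms(2) by simp
  qed
  then obtain j where "card {z \<in> Z. g z = j} \<ge> 3"
    by blast
  then obtain T where "T \<subseteq> {z \<in> Z. g z = j}" "card T = 3"
    by (meson obtain_subset_with_card_n)
  then obtain u v w where "T = {u, v, w}" "u \<noteq> v" "v \<noteq> w" "u \<noteq> w"
    unfolding card_3_iff by blast
  moreover from this \<open>T \<subseteq> _\<close> have "u \<in> Z \<and> g u = j" "v \<in> Z \<and> g v = j" "w \<in> Z \<and> g w = j"
    by blast+
  ultimately show ?thesis
    by (intro that[of u v w]) simp_all
qed

text \<open>A chord is no longer than its arc: after a rotation this is |exp(it) - 1| = 2|sin(t/2)|
  and |sin(t/2)| <= |t/2|.\<close>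

lemma chord_le_angle:
  assumes "norm u = R" "norm v = R"
  shows "norm (u - v) \<le> R * \<bar>Arg2pi u - Arg2pi v\<bar>"
proof -
  let ?t = "Arg2pi u - Arg2pi v"
  have u: "u = R * exp (\<i> * Arg2pi u)" and v: "v = R * exp (\<i> * Arg2pi v)"
    using Arg2pi_eq[of u] Arg2pi_eq[of v] assms by simp_all
  have "exp (\<i> * Arg2pi v) * exp (\<i> * ?t) = exp (\<i> * Arg2pi u)"
    by (simp add: algebra_simps flip: exp_add)
  then have "u - v = R * exp (\<i> * Arg2pi v) * (exp (\<i> * ?t) - 1)"
    by (subst u, subst v) (simp add: algebra_simps)
  then have "norm (u - v) = \<bar>R\<bar> * (2 * \<bar>sin (?t / 2)\<bar>)"
    using dist_exp_i_1[of ?t] by (simp add: norm_mult)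
  also have "\<dots> \<le> R * \<bar>?t\<bar>"
    using abs_sin_x_le_abs_x[of "?t / 2"] assms norm_ge_zero[of u] by (simp add: mult_left_mono)
  finally show ?thesis .
qed

text \<open>Cut the circle into \<open>n\<close> equal arcs. With more than \<open>2 * n\<close>
  points, three share an arc. Integrality and \<open>circle_chord_identity\<close> give their
  squared sides a product of at least R^2, while the arc length bounds it by (2 pi R / n)^6;
  \<open>n\<close> is assumed too large for both.\<close>

lemma card_circle_integral_distances:
  fixes Z :: "complex set" and n :: nat
  assumes fin: "finite Z" and R: "R > 0" and norm: "\<And>z. z \<in> Z \<Longrightarrow> norm z = R"
    and int: "\<And>u v. u \<in> Z \<Longrightarrow> v \<in> Z \<Longrightarrow> (norm (u - v))\<^sup>2 \<in> \<int>"
    and n: "(2 * pi) ^ 6 * R ^ 4 < real n ^ 6"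
  shows "card Z \<le> 2 * n"
proof (rule ccontr)
  assume many: "\<not> ?thesis"
  have n0: "n > 0"
    using n R by (cases n) (auto simp: mult_less_0_iff)
  \<comment> \<open>\<open>g z\<close> is the index of the arc that contains
    \<open>z\<close>.\<close>
  define g where "g z = nat \<lfloor>real n * Arg2pi z / (2 * pi)\<rfloor>" for z
  have g_bounds: "real (g z) \<le> real n * Arg2pi z / (2 * pi)" "real n * Arg2pi z / (2 * pi) < real (g z) + 1" for z
    unfolding g_def using Arg2pi_ge_0[of z] by (simp_all add: of_nat_floor, linarith?)
  have card_gt: "2 * n < card Z"
    using many by simp
  have g_less: "g z < n" if "z \<in> Z" for z
  proof -
    have "real n * Arg2pi z / (2 * pi) < real n"
      using n0 Arg2pi_lt_2pi[of z] by (simp add: field_simps)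
    then show ?thesis
      using g_bounds(1)[of z] by linarith
  qed
  obtain u v w where Z: "u \<in> Z" "v \<in> Z" "w \<in> Z" and ne: "u \<noteq> v" "v \<noteq> w" "u \<noteq> w"
    and g: "g u = g v" "g v = g w"
    by (rule pigeonhole_three[OF fin card_gt g_less])
  have close: "(norm (y - z))\<^sup>2 \<le> (R * (2 * pi / n))\<^sup>2" if "g y = g z" "y \<in> Z" "z \<in> Z" for y z
  proof -
    have "\<bar>real n * Arg2pi y / (2 * pi) - real n * Arg2pi z / (2 * pi)\<bar> \<le> 1"
      using g_bounds[of y] g_bounds[of z] that(1) by linarith
    moreover have "real n * Arg2pi y / (2 * pi) - real n * Arg2pi z / (2 * pi)
        = real n / (2 * pi) * (Arg2pi y - Arg2pi z)"
      by (simp add: algebra_simps diff_divide_distrib)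
    ultimately have "real n / (2 * pi) * \<bar>Arg2pi y - Arg2pi z\<bar> \<le> 1"
      by (simp add: abs_mult)
    then have "\<bar>Arg2pi y - Arg2pi z\<bar> \<le> 2 * pi / n"
      using n0 by (simp add: field_simps)
    then have "norm (y - z) \<le> R * (2 * pi / n)"
      using chord_le_angle[of y R z] norm that R by (smt (verit) mult_left_mono)
    then show ?thesis
      by (intro power_mono) auto
  qed
  define a b c where "a = (norm (u - v))\<^sup>2" and "b = (norm (v - w))\<^sup>2" and "c = (norm (u - w))\<^sup>2"
  have pos: "a > 0" "b > 0" "c > 0"
    using ne by (auto simp: a_def b_def c_def)
  have id: "a * b * c = R\<^sup>2 * (4 * a * b - (a + b - c)\<^sup>2)"
    unfolding a_def b_def c_def by (rule circle_chord_identity) (use norm Z in auto)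
  \<comment> \<open>The area factor is a positive integer, so three points in one arc have \<open>abc \<ge> R\<^sup>2\<close>.\<close>
  have "a \<in> \<int>" "b \<in> \<int>" "c \<in> \<int>"
    using int Z by (auto simp: a_def b_def c_def)
  then have "4 * a * b - (a + b - c)\<^sup>2 \<in> \<int>"
    by (intro Ints_diff Ints_mult Ints_power Ints_add Ints_numeral)
  moreover have "4 * a * b - (a + b - c)\<^sup>2 > 0"
    using id pos R by (metis mult_pos_pos zero_less_mult_pos zero_less_power)
  ultimately have "4 * a * b - (a + b - c)\<^sup>2 \<ge> 1"
    by (auto elim!: Ints_cases)
  then have "R\<^sup>2 \<le> a * b * c"
    unfolding id using R by simp
  also have "\<dots> \<le> (R * (2 * pi / n))\<^sup>2 * (R * (2 * pi / n))\<^sup>2 * (R * (2 * pi / n))\<^sup>2"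
    unfolding a_def b_def c_def using g Z by (intro mult_mono close) auto
  also have "\<dots> = R\<^sup>2 * ((2 * pi) ^ 6 * R ^ 4 / real n ^ 6)"
    by (simp add: power_mult_distrib power_divide flip: power_add power_mult)
       (simp add: eval_nat_numeral)
  finally have "R\<^sup>2 * 1 \<le> R\<^sup>2 * ((2 * pi) ^ 6 * R ^ 4 / real n ^ 6)"
    by simp
  then have "1 \<le> (2 * pi) ^ 6 * R ^ 4 / real n ^ 6"
    using R by (subst (asm) mult_le_cancel_left_pos) auto
  then show False
    using n n0 by (simp add: field_simps)
qed

section \<open>Small primes not dividing an integer\<close>

text \<open>Erdos: a positive integer is determined by the primes of its squarefree part and its square part.\<close>

lemma le_four_power_card_primes:
  fixes X :: nat
  shows "X \<le> 4 ^ card {q. prime q \<and> q \<le> X}"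
proof (cases "X = 0")
  case False
  define P where "P = {q. prime q \<and> q \<le> X}"
  define k where "k = card P"
  have fin: "finite P"
    unfolding P_def by (rule finite_subset[of _ "{..X}"]) auto
  define f where "f n = (prime_factors (squarefree_part n), square_part n)" for n :: nat
  have inj: "inj_on f {1..X}"
  proof (rule inj_onI)
    fix a b assume ab: "a \<in> {1..X}" "b \<in> {1..X}" "f a = f b"
    have "squarefree_part n = \<Prod>(prime_factors (squarefree_part n))" for n :: nat
    proof -
      have "multiplicity p (squarefree_part n) = 1" if "p \<in> prime_factors (squarefree_part n)" for p
        using that prime_multiplicity_squarefree_part_le_Suc_0[of p n]
        by (metis One_nat_def Suc_leI le_antisym in_prime_factors_iff prime_factors_multiplicity
            mem_Collect_eq)
      then show ?thesis
        using prime_factorization_nat[of "squarefree_part n"] by (simp add: zero_less_iff_neq_zero)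
    qed
    then have "squarefree_part a = squarefree_part b"
      using ab by (metis Pair_inject f_def)
    then show "a = b"
      using ab squarefree_decomposition_unique[of a b] by (simp add: f_def)
  qed
  have "f ` {1..X} \<subseteq> Pow P \<times> {1..floor_sqrt X}"
  proof clarify
    fix n S y assume n: "n \<in> {1..X}" and f: "(S, y) = f n"
    have "squarefree_part n dvd n" "square_part n ^ 2 dvd n"
      using squarefree_decompose[of n] by (metis dvd_triv_left) (rule square_part_square_dvd)
    then have "squarefree_part n \<le> n" "square_part n ^ 2 \<le> n"
      using n by (simp_all only: atLeastAtMost_iff dvd_imp_le zero_less_one order.strict_trans2[of 0 1 n])
    then have "squarefree_part n \<le> X" "square_part n ^ 2 \<le> X"
      using n by simp_all
    moreover have "squarefree_part n > 0" "square_part n > 0"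
      using n by (auto intro!: Nat.gr0I)
    ultimately show "S \<in> Pow P \<and> y \<in> {1..floor_sqrt X}"
      using f n by (auto simp: f_def P_def le_floor_sqrt_iff Suc_le_eq in_prime_factors_iff
            dest!: dvd_imp_le)
  qed
  then have "card {1..X} \<le> card (Pow P \<times> {1..floor_sqrt X})"
    using inj fin by (intro card_inj_on_le[of f]) auto
  \<comment> \<open>There are at most \<open>2 ^ k\<close> squarefree parts and
    \<open>floor_sqrt X\<close> square parts. Squaring this and cancelling one factor
    \<open>X\<close> gives the claim.\<close>
  then have "X \<le> 2 ^ k * floor_sqrt X"
    using fin by (simp add: card_cartesian_product card_Pow k_def)
  then have "X\<^sup>2 \<le> (2 ^ k * floor_sqrt X)\<^sup>2"
    by (intro power_mono) auto
  also have "\<dots> = 4 ^ k * (floor_sqrt X)\<^sup>2"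
    by (simp add: power_mult_distrib flip: power_mult) (simp add: power_mult mult.commute[of k])
  also have "\<dots> \<le> 4 ^ k * X"
    by simp
  finally show ?thesis
    using False by (simp add: power2_eq_square k_def P_def)
qed simp

text \<open>The j-th smallest element of a set of positive integers is at least j; the induction
  adds the elements in increasing order.\<close>

lemma fact_card_le_prod:
  fixes A :: "nat set"
  assumes "finite A" "0 \<notin> A"
  shows "fact (card A) \<le> \<Prod>A"
  using assms
proof (induction A rule: finite_linorder_max_induct)
  case (insert b A)
  have "insert b A \<subseteq> {1..b}"
    using insert by (force simp: Suc_le_eq intro: Nat.gr0I)
  then have "card (insert b A) \<le> b"
    using card_mono[of "{1..b}" "insert b A"] by simp
  moreover have "b \<notin> A"
    using insert by auto
  ultimately show ?case
    using insert by (simp add: mult_le_mono del: mult_Suc)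
qed simp

lemma prod_primes_dvd:
  fixes d :: nat
  assumes "finite A" "\<And>p. p \<in> A \<Longrightarrow> prime p" "\<And>p. p \<in> A \<Longrightarrow> p dvd d"
  shows "\<Prod>A dvd d"
  using assms
proof (induction A rule: finite_induct)
  case (insert p A)
  have "coprime p (\<Prod>A)"
    using insert by (intro prod_coprime_right) (metis insertCI primes_coprime)
  then show ?case
    using insert by (simp add: divides_mult)
qed simp

text \<open>The terms of the exponential series tend to zero.\<close>

lemma eventually_power_less_fact:
  fixes c b :: real
  shows "\<forall>\<^sub>F n in sequentially. c * b ^ n < fact n"
proof -
  have "(\<lambda>n. c * (inverse (fact n) * b ^ n)) \<longlonglongrightarrow> c * 0"
    by (intro tendsto_mult_left summable_LIMSEQ_zero summable_exp)
  then have "\<forall>\<^sub>F n in sequentially. c * (inverse (fact n) * b ^ n) < 1"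
    by (intro order_tendstoD(2)) auto
  then show ?thesis
    by eventually_elim (simp add: field_simps)
qed

text \<open>Let \<open>p\<close> be the least prime above \<open>P0\<close> not dividing
  \<open>d\<close>, and let j primes lie strictly between \<open>P0\<close> and \<open>p\<close>.
  They all divide \<open>d\<close>, so j! <= \<open>d\<close> <= \<open>C * p ^ 6\<close>. Counting
  primes gives \<open>p\<close> <= 2 * 4^(j + P0), so the right side is only exponential in j. Hence
  j, and with it \<open>p\<close>, is bounded in terms of \<open>P0\<close> and
  \<open>C\<close>.\<close>

lemma small_prime_not_dvd:
  fixes P0 C :: nat
  obtains M where "\<And>d. d > 0 \<Longrightarrow> (\<And>p. prime p \<Longrightarrow> p > P0 \<Longrightarrow> \<not> p dvd d \<Longrightarrow> d \<le> C * p ^ 6) \<Longrightarrow>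
     \<exists>p. prime p \<and> p > P0 \<and> \<not> p dvd d \<and> p \<le> M"
proof -
  \<comment> \<open>The constants come from (2 * 4^(P0 + j))^6 = 64 * 4096^P0 * 4096^j.\<close>
  obtain J where J: "\<And>j. j \<ge> J \<Longrightarrow> real (C * 64 * 4096 ^ P0) * 4096 ^ j < fact j"
    using eventually_power_less_fact unfolding eventually_sequentially by metis
  show ?thesis
  proof (rule that[of "4 ^ (J + P0) + 1"])
    fix d :: nat
    assume d: "d > 0" and le: "\<And>p. prime p \<Longrightarrow> p > P0 \<Longrightarrow> \<not> p dvd d \<Longrightarrow> d \<le> C * p ^ 6"
    define good where "good p \<longleftrightarrow> prime p \<and> p > P0 \<and> \<not> p dvd d" for p
    \<comment> \<open>A prime beyond \<open>d\<close> cannot divide \<open>d\<close>, so the least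
      good prime exists.\<close>
    obtain q where "prime q" "q > max P0 d"
      using bigger_prime by blast
    then have "good q"
      using d unfolding good_def by (auto dest: dvd_imp_le)
    define p where "p = (LEAST p. good p)"
    have p: "good p"
      unfolding p_def by (rule LeastI) fact
    define A where "A = {q. prime q \<and> P0 < q \<and> q \<le> p - 1}"
    have "q dvd d" if "q \<in> A" for q
    proof (rule ccontr)
      assume "\<not> q dvd d"
      then have "p \<le> q"
        using that unfolding p_def by (intro Least_le) (auto simp: good_def A_def)
      then show False
        using that prime_gt_0_nat[of q] by (auto simp: A_def)
    qed
    moreover have finA: "finite A"
      unfolding A_def by (rule finite_subset[of _ "{..p}"]) auto
    ultimately have "\<Prod>A dvd d"
      by (intro prod_primes_dvd) (auto simp: A_def)
    then have "\<Prod>A \<le> d"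
      using d by (rule dvd_imp_le)
    moreover have "fact (card A) \<le> \<Prod>A"
      using finA by (intro fact_card_le_prod) (auto simp: A_def)
    ultimately have "fact (card A) \<le> C * p ^ 6"
      using le[of p] p by (auto simp: good_def)
    have "{q. prime q \<and> q \<le> p - 1} \<subseteq> A \<union> {1..P0}"
      by (auto simp: A_def Suc_le_eq prime_gt_0_nat)
    then have "card {q. prime q \<and> q \<le> p - 1} \<le> card (A \<union> {1..P0})"
      using finA by (intro card_mono) auto
    also have "\<dots> \<le> card A + P0"
      using card_Un_le[of A "{1..P0}"] by simp
    finally have "(4::nat) ^ card {q. prime q \<and> q \<le> p - 1} \<le> 4 ^ (card A + P0)"
      by (intro power_increasing) auto
    then have p_le: "p - 1 \<le> 4 ^ (card A + P0)"
      using le_four_power_card_primes[of "p - 1"] by linarith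
    then have "p \<le> 2 * 4 ^ (card A + P0)"
      using one_le_power[of "4::nat" "card A + P0"] by linarith
    then have "p ^ 6 \<le> (2 * 4 ^ (card A + P0)) ^ 6"
      by (intro power_mono) auto
    also have "\<dots> = 64 * 4096 ^ P0 * 4096 ^ card A"
      by (simp add: power_mult_distrib power_add flip: power_mult) 
         (simp add: power_mult mult.commute[of _ 6])
    finally have "C * p ^ 6 \<le> C * (64 * 4096 ^ P0 * 4096 ^ card A)"
      by (rule mult_le_mono2)
    then have "fact (card A) \<le> C * 64 * 4096 ^ P0 * 4096 ^ card A"
      using \<open>fact (card A) \<le> C * p ^ 6\<close> unfolding mult.assoc by linarith
    then have "(fact (card A) :: real) \<le> real (C * 64 * 4096 ^ P0) * 4096 ^ card A"
      by (metis (mono_tags, lifting) of_nat_fact of_nat_le_iff of_nat_mult of_nat_numeral of_nat_power)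
    then have "card A < J"
      using J[of "card A"] by (meson not_le)
    then have "(4::nat) ^ (card A + P0) \<le> 4 ^ (J + P0)"
      by (intro power_increasing) auto
    then have "p \<le> 4 ^ (J + P0) + 1"
      using p_le by linarith
    then show "\<exists>p. prime p \<and> p > P0 \<and> \<not> p dvd d \<and> p \<le> 4 ^ (J + P0) + 1"
      using p unfolding good_def by (intro exI[of _ p]) auto
  qed
qed

section \<open>Ternary lattices\<close>

lemma ternary_latticeD:
  assumes "ternary_lattice L"
  shows "symmetric_bilinear (bform L)" "x \<noteq> 0 \<Longrightarrow> qform L x > 0" "\<exists>b. lattice_basis b (lat L)"
    "x \<in> lat L \<Longrightarrow> qform L x \<in> \<int>"
  using assms rat_int.span_base[of "qform L x" "qform L ` lat L"] by (auto simp: ternary_lattice_def)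

lemma qform_nonneg:
  assumes "ternary_lattice L"
  shows "qform L x \<ge> 0"
proof (cases "x = 0")
  case True
  then show ?thesis
    using symmetric_bilinearD(4)[OF ternary_latticeD(1)[OF assms], of 0 0 0] by (simp add: qform_def)
qed (use ternary_latticeD(2)[OF assms] in force)

lemma lattice_basis_comb_closed:
  fixes c :: "'a \<Rightarrow> int"
  assumes "lattice_basis b M" "\<And>i. i \<in> I \<Longrightarrow> x i \<in> M"
  shows "(\<Sum>i\<in>I. of_int (c i) *s x i) \<in> M"
proof -
  have M: "M = {\<Sum>i\<in>UNIV. of_int (c i) *s b i | c :: 3 \<Rightarrow> int. True}"
    using assms(1) by (simp only: lattice_basis_def)
  have "\<forall>i\<in>I. \<exists>d. x i = (\<Sum>j\<in>UNIV. of_int (d j :: int) *s b j)"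
    using assms(2) unfolding M by auto
  then obtain d where d: "\<And>i. i \<in> I \<Longrightarrow> x i = (\<Sum>j\<in>UNIV. of_int (d i j :: int) *s b j)"
    by metis
  have "(\<Sum>i\<in>I. of_int (c i) *s x i) = (\<Sum>i\<in>I. \<Sum>j\<in>UNIV. of_int (c i * d i j) *s b j)"
    by (intro sum.cong refl) (simp add: d vec.scale_sum_right)
  also have "\<dots> = (\<Sum>j\<in>UNIV. \<Sum>i\<in>I. of_int (c i * d i j) *s b j)"
    by (rule sum.swap)
  also have "\<dots> = (\<Sum>j\<in>UNIV. of_int (\<Sum>i\<in>I. c i * d i j) *s b j)"
    by (simp add: vec.scale_sum_left)
  finally show ?thesis
    unfolding M by (intro CollectI exI[of _ "\<lambda>j. \<Sum>i\<in>I. c i * d i j"]) simp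
qed

lemma lat_closed:
  assumes "ternary_lattice L"
  shows "(\<And>i. i \<in> I \<Longrightarrow> x i \<in> lat L) \<Longrightarrow> (\<Sum>i\<in>I. of_int (c i) *s x i) \<in> lat L"
    and "y \<in> lat L \<Longrightarrow> z \<in> lat L \<Longrightarrow> y + z \<in> lat L"
    and "y \<in> lat L \<Longrightarrow> z \<in> lat L \<Longrightarrow> y - z \<in> lat L"
    and "y \<in> lat L \<Longrightarrow> - y \<in> lat L"
proof -
  obtain b where b: "lattice_basis b (lat L)"
    using ternary_latticeD(3)[OF assms] by blast
  show "(\<And>i. i \<in> I \<Longrightarrow> x i \<in> lat L) \<Longrightarrow> (\<Sum>i\<in>I. of_int (c i) *s x i) \<in> lat L"
    using b by (rule lattice_basis_comb_closed)
  \<comment> \<open>Sums and differences are read as integral combinations of a family indexed by 0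
    and 1.\<close>
  note comb = lattice_basis_comb_closed[OF b, of "{..<2::nat}" "\<lambda>i. if i = 0 then y else z"]
  show "y \<in> lat L \<Longrightarrow> z \<in> lat L \<Longrightarrow> y + z \<in> lat L"
    using comb[of "\<lambda>_. 1"] by (simp add: numeral_2_eq_2)
  show "y \<in> lat L \<Longrightarrow> z \<in> lat L \<Longrightarrow> y - z \<in> lat L"
    using comb[of "\<lambda>i. if i = 0 then 1 else -1"] by (simp add: numeral_2_eq_2)
  show "y \<in> lat L \<Longrightarrow> - y \<in> lat L"
    using lattice_basis_comb_closed[OF b, of "{0::nat}" "\<lambda>_. y" "\<lambda>_. -1"] by simp
qed

lemma qform_add:
  assumes "symmetric_bilinear (bform L)"
  shows "qform L (x + y) = qform L x + qform L y + 2 * bform L x y"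
    and "qform L (x - y) = qform L x + qform L y - 2 * bform L x y"
    and "qform L (- x) = qform L x"
proof -
  note B = symmetric_bilinearD[OF assms]
  have neg: "bform L z (- x) = - bform L z x" "bform L (- x) z = - bform L x z" for x z
    using B(4)[of z "-1" x] B(5)[of "-1" x z] by simp_all
  show *: "qform L (x + y) = qform L x + qform L y + 2 * bform L x y" for y
    using B(1)[of x y] by (simp add: qform_def B(2,3))
  show **: "qform L (- x) = qform L x" for x
    by (simp add: qform_def neg)
  show "qform L (x - y) = qform L x + qform L y - 2 * bform L x y"
    using *[of "- y"] by (simp add: neg **)
qed

lemma double_bform_Ints:
  assumes "ternary_lattice L" "x \<in> lat L" "y \<in> lat L"
  shows "2 * bform L x y \<in> \<int>"
proof -
  have "2 * bform L x y = qform L (x + y) - qform L x - qform L y"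
    using qform_add(1)[OF ternary_latticeD(1)[OF assms(1)]] by simp
  then show ?thesis
    using assms by (simp add: Ints_diff ternary_latticeD(4) lat_closed(2))
qed

text \<open>Nonnegativity of Q(x + y) and Q(x - y) replaces Cauchy-Schwarz and stays within the
  rationals.\<close>

lemma abs_bform_le:
  assumes "ternary_lattice L" "qform L x \<le> N" "qform L y \<le> N"
  shows "\<bar>bform L x y\<bar> \<le> N"
  using qform_nonneg[OF assms(1), of "x + y"] qform_nonneg[OF assms(1), of "x - y"] assms(2,3)
  unfolding qform_add(1,2)[OF ternary_latticeD(1)[OF assms(1)]] by linarith

lemma abs_det_3_le:
  fixes A :: "'a::linordered_idom^3^3"
  assumes "\<And>i j. \<bar>A $ i $ j\<bar> \<le> K"
  shows "\<bar>det A\<bar> \<le> 6 * K ^ 3"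
proof -
  have "\<bar>A $ a $ b * A $ c $ d * A $ e $ f\<bar> \<le> K ^ 3" for a b c d e f
    unfolding abs_mult power3_eq_cube using assms order.trans[OF abs_ge_zero assms]
    by (intro mult_mono) auto
  then have *: "A $ a $ b * A $ c $ d * A $ e $ f \<le> K ^ 3" "- (A $ a $ b * A $ c $ d * A $ e $ f) \<le> K ^ 3"
    for a b c d e f
    by (auto simp: abs_le_iff)
  show ?thesis
    using *[of 1 1 2 2 3 3] *[of 1 2 2 3 3 1] *[of 1 3 2 1 3 2] *[of 1 1 2 3 3 2] *[of 1 2 2 1 3 3]
      *[of 1 3 2 2 3 1] unfolding det_3 abs_le_iff by linarith
qed

section \<open>Gram determinants, linear independence and the discriminant\<close>

lemma gram_mult_vector:
  assumes "symmetric_bilinear (bform L)"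
  shows "(gram L v *v c) $ i = bform L (v i) (\<Sum>j\<in>UNIV. c $ j *s v j)"
  by (simp add: matrix_vector_mult_def gram_def symmetric_bilinearD(4,6)[OF assms] mult.commute)

lemma det_nonzero_iff_ker:
  fixes A :: "'a::field^'n^'n"
  shows "det A \<noteq> 0 \<longleftrightarrow> (\<forall>c. A *v c = 0 \<longrightarrow> c = 0)"
  using matrix_left_invertible_ker[of A] by (simp add: invertible_left_inverse flip: invertible_det_nz)

text \<open>A kernel vector \<open>c\<close> of the Gram matrix gives a combination orthogonal to
  every \<open>v i\<close>, hence to itself; positive definiteness makes it zero.\<close>

lemma det_gram_nonzeroI:
  assumes L: "ternary_lattice L"
    and indep: "\<And>c. (\<Sum>i\<in>UNIV. c $ i *s v i) = 0 \<Longrightarrow> c = 0"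
  shows "det (gram L v) \<noteq> 0"
  unfolding det_nonzero_iff_ker
proof (intro allI impI)
  fix c assume c: "gram L v *v c = 0"
  note sb = ternary_latticeD(1)[OF L]
  let ?x = "\<Sum>j\<in>UNIV. c $ j *s v j"
  have "qform L ?x = (\<Sum>i\<in>UNIV. c $ i * bform L (v i) ?x)"
    unfolding qform_def by (subst symmetric_bilinearD(7)[OF sb]) (simp add: symmetric_bilinearD(5)[OF sb])
  also have "\<dots> = 0"
    using c by (simp flip: gram_mult_vector[OF sb])
  finally show "c = 0"
    using ternary_latticeD(2)[OF L, of ?x] indep by fastforce
qed

text \<open>A linear relation among the \<open>v i\<close> is a kernel vector of their Gram
  matrix.\<close>

lemma det_gram_nonzeroD:
  assumes "symmetric_bilinear (bform L)" "det (gram L v) \<noteq> 0" "(\<Sum>i\<in>UNIV. c $ i *s v i) = 0"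
  shows "c = 0"
proof -
  have "bform L x 0 = 0" for x
    using symmetric_bilinearD(4)[OF assms(1), of x 0 0] by simp
  then have "gram L v *v c = 0"
    by (simp add: vec_eq_iff gram_mult_vector[OF assms(1)] assms(3))
  then show ?thesis
    using assms(2) det_nonzero_iff_ker by blast
qed

lemma lattice_basis_independent:
  assumes "lattice_basis b M" "(\<Sum>i\<in>UNIV. c $ i *s b i) = 0"
  shows "c = 0"
proof -
  let ?A = "transpose (\<chi> i. b i)"
  have "?A *v c = (\<Sum>i\<in>UNIV. c $ i *s b i)"
    by (simp add: vec_eq_iff matrix_vector_mult_def transpose_def mult.commute)
  moreover have "det ?A \<noteq> 0"
    using lattice_basis_det_nonzero[OF assms(1)] by (simp add: det_transpose)
  ultimately show ?thesis
    using assms(2) unfolding det_nonzero_iff_ker by metis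
qed

lemma disc_nonzero:
  assumes "ternary_lattice L"
  shows "disc L \<noteq> 0"
proof -
  obtain b where b: "lattice_basis b (lat L)"
    using ternary_latticeD(3)[OF assms] by blast
  then show ?thesis
    unfolding disc_eq[OF assms b]
    using det_gram_nonzeroI[OF assms] lattice_basis_independent[OF b] by blast
qed

lemma gram_change:
  fixes C :: "rat^3^3"
  assumes "symmetric_bilinear (bform L)" "\<And>i. v i = (\<Sum>j\<in>UNIV. C $ i $ j *s b j)"
  shows "gram L v = C ** gram L b ** transpose C"
proof -
  have "gram L v $ i $ j = (C ** gram L b ** transpose C) $ i $ j" for i j
  proof -
    have "gram L v $ i $ j =
        (\<Sum>l\<in>UNIV. \<Sum>k\<in>UNIV. C $ i $ k * bform L (b k) (b l) * C $ j $ l)"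
      by (simp add: gram_def assms(2) symmetric_bilinearD(4-)[OF assms(1)] sum_distrib_left mult_ac)
    also have "\<dots> = (C ** gram L b ** transpose C) $ i $ j"
      by (simp add: gram_def matrix_matrix_mult_def transpose_def sum_distrib_right)
    finally show ?thesis .
  qed
  then show ?thesis
    by (simp add: vec_eq_iff)
qed

text \<open>Expressing \<open>v\<close> in a lattice basis by an integral matrix \<open>C\<close>
  multiplies the discriminant by the square of \<open>det C\<close>, a nonzero integer.\<close>

lemma abs_disc_le_det_gram:
  assumes L: "ternary_lattice L" and v: "\<And>i. v i \<in> lat L" and det: "det (gram L v) \<noteq> 0"
  shows "\<bar>disc L\<bar> \<le> \<bar>det (gram L v)\<bar>"
proof -
  obtain b where b: "lattice_basis b (lat L)"
    using ternary_latticeD(3)[OF L] by blast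
  have lat: "lat L = {\<Sum>i\<in>UNIV. of_int (c i) *s b i | c :: 3 \<Rightarrow> int. True}"
    using b by (simp only: lattice_basis_def)
  have "\<forall>i. \<exists>c. v i = (\<Sum>j\<in>UNIV. of_int (c j :: int) *s b j)"
    using v unfolding lat by blast
  then obtain c where c: "\<And>i. v i = (\<Sum>j\<in>UNIV. of_int (c i j :: int) *s b j)"
    by metis
  define C :: "rat^3^3" where "C = (\<chi> i j. of_int (c i j))"
  have "gram L v = C ** gram L b ** transpose C"
    by (rule gram_change[OF ternary_latticeD(1)[OF L]]) (simp add: c C_def)
  then have eq: "det (gram L v) = (det C)\<^sup>2 * disc L"
    by (simp add: det_mul disc_eq[OF L b] power2_eq_square)
  obtain k where k: "det C = of_int k"
    using det_Ints[of C] by (auto simp: C_def elim: Ints_cases)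
  have "k \<noteq> 0"
    using eq det k by auto
  then have "k\<^sup>2 \<ge> 1"
    by (simp add: int_one_le_iff_zero_less)
  then have "(det C)\<^sup>2 \<ge> 1"
    unfolding k by (metis of_int_1_le_iff of_int_power)
  then show ?thesis
    unfolding eq abs_mult by (simp add: mult_le_cancel_right1)
qed

text \<open>The constant 24 is 4 from \<open>disc4\<close> times the 6 terms of a 3 by 3
  determinant.\<close>

lemma abs_disc4_le:
  assumes L: "ternary_lattice L" and v: "\<And>i. v i \<in> lat L" "\<And>i. qform L (v i) \<le> N"
    and det: "det (gram L v) \<noteq> 0"
  shows "of_int \<bar>disc4 L\<bar> \<le> 24 * N ^ 3"
proof -
  have "\<bar>det (gram L v)\<bar> \<le> 6 * N ^ 3"
    by (rule abs_det_3_le) (simp add: gram_def abs_bform_le[OF L v(2) v(2)])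
  then have "4 * \<bar>disc L\<bar> \<le> 24 * N ^ 3"
    using abs_disc_le_det_gram[OF L v(1) det] by simp
  then show ?thesis
    using disc4_eq[OF L] by (simp add: abs_mult)
qed

section \<open>Many vectors of one length contain an independent triple\<close>

lemma qform_comb2:
  assumes "symmetric_bilinear (bform L)"
  shows "qform L (a *s x + b *s y) = a\<^sup>2 * qform L x + 2 * a * b * bform L x y + b\<^sup>2 * qform L y"
  using symmetric_bilinearD(1)[OF assms, of y x]
  by (simp add: qform_def symmetric_bilinearD(2-5)[OF assms] power2_eq_square algebra_simps)

text \<open>Two non-proportional vectors of \<open>W\<close> span a plane. A vector of
  \<open>W\<close> outside it completes the triple. Otherwise the plane embeds isometrically into
  the complex numbers and \<open>W\<close> lands on a circle of radius sqrt N with integral squared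
  distances, too many points for \<open>card_circle_integral_distances\<close>.\<close>

lemma independent_triple:
  assumes L: "ternary_lattice L" and W: "W = {x \<in> lat L. qform L x = of_nat N}"
    and card: "card W > 2 * n" and n: "(2 * pi) ^ 6 * real N ^ 2 < real n ^ 6"
  shows "\<exists>v. (\<forall>i. v i \<in> W) \<and> det (gram L v) \<noteq> 0"
proof -
  note sb = ternary_latticeD(1)[OF L]
  have Q0: "qform L 0 = 0"
    using symmetric_bilinearD(4)[OF sb, of 0 0 0] by (simp add: qform_def)
  have "n > 0"
    using n by (cases n) (auto simp: mult_less_0_iff)
  \<comment> \<open>Infinite sets have \<open>card\<close> 0, so a positive cardinality also gives
    finiteness.\<close>
  then have "card W > 2" and finW: "finite W"
    using card card_ge_0_finite[of W] by auto
  then obtain v0 where v0: "v0 \<in> W"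
    by fastforce
  have "card {v0, - v0} \<le> 2"
    by (simp add: card_insert_if)
  then have "\<not> W \<subseteq> {v0, - v0}"
    using \<open>card W > 2\<close> card_mono[of "{v0, - v0}" W] by auto
  then obtain v1 where v1: "v1 \<in> W" "v1 \<noteq> v0" "v1 \<noteq> - v0"
    by blast
  have Qv: "qform L v0 = of_nat N" "qform L v1 = of_nat N"
    using v0 v1 by (auto simp: W)
  have "N > 0"
  proof (rule ccontr)
    assume "\<not> N > 0"
    then have "v0 = 0" "v1 = 0"
      using Qv ternary_latticeD(2)[OF L, of v0] ternary_latticeD(2)[OF L, of v1] by auto
    then show False
      using v1 by simp
  qed
  have v0_nonzero: "v0 \<noteq> 0"
    using Qv Q0 \<open>N > 0\<close> by auto
  show ?thesis
  proof (cases "\<forall>w\<in>W. \<exists>a b. w = a *s v0 + b *s v1")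
    case False
    then obtain w where w: "w \<in> W" "\<And>a b. w \<noteq> a *s v0 + b *s v1"
      by blast
    define v :: "3 \<Rightarrow> rat^3" where "v i = (if i = 1 then v0 else if i = 2 then v1 else w)" for i
    have "det (gram L v) \<noteq> 0"
    proof (rule det_gram_nonzeroI[OF L])
      fix c :: "rat^3" assume "(\<Sum>i\<in>UNIV. c $ i *s v i) = 0"
      then have rel: "c $ 1 *s v0 + c $ 2 *s v1 + c $ 3 *s w = 0"
        by (simp add: sum_3 v_def)
      have c3: "c $ 3 = 0"
      proof (rule ccontr)
        assume "c $ 3 \<noteq> 0"
        then have "w = (- c $ 1 / c $ 3) *s v0 + (- c $ 2 / c $ 3) *s v1"
          using rel by (simp add: vec_eq_iff field_simps eq_neg_iff_add_eq_0)
        then show False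
          using w by blast
      qed
      \<comment> \<open>Proportional vectors of equal nonzero length agree up to sign, which the
        choice of \<open>v1\<close> excludes.\<close>
      have c2: "c $ 2 = 0"
      proof (rule ccontr)
        assume nz: "c $ 2 \<noteq> 0"
        define t where "t = - c $ 1 / c $ 2"
        have "v1 = t *s v0"
          using rel c3 nz by (simp add: t_def vec_eq_iff field_simps eq_neg_iff_add_eq_0)
        moreover from this have "t\<^sup>2 * of_nat N = (of_nat N :: rat)"
          using Qv qform_comb2[OF sb, of t v0 0 0] by simp
        then have "t = 1 \<or> t = -1"
          using \<open>N > 0\<close> by (simp add: power2_eq_1_iff)
        ultimately show False
          using v1 by auto
      qed
      have "c $ 1 = 0"
        using rel c2 c3 v0_nonzero by simp
      then show "c = 0"
        using c2 c3 by (simp add: vec_eq_iff forall_3)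
    qed
    moreover have "v i \<in> W" for i
      using v0 v1 w by (simp add: v_def)
    ultimately show ?thesis
      by blast
  next
    case True
    then obtain a b where ab: "\<And>w. w \<in> W \<Longrightarrow> w = a w *s v0 + b w *s v1"
      by metis
    define x where "x = bform L v0 v1"
    have Qcomb: "qform L (s *s v0 + t *s v1) = s\<^sup>2 * of_nat N + 2 * s * t * x + t\<^sup>2 * of_nat N" for s t
      by (simp add: qform_comb2[OF sb] Qv x_def)
    \<comment> \<open>Definiteness at \<open>v0 - v1\<close> and \<open>v0 + v1\<close> bounds
      \<open>x\<close>, so that the square root in \<open>\<phi>\<close> below has a nonnegative
      argument.\<close>
    have "qform L (v0 - v1) > 0" "qform L (v0 + v1) > 0"
      using v1 ternary_latticeD(2)[OF L, of "v0 - v1"] ternary_latticeD(2)[OF L, of "v0 + v1"]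
      by (auto simp: eq_neg_iff_add_eq_0 add.commute)
    then have "\<bar>x\<bar> < of_nat N"
      unfolding qform_add[OF sb] Qv x_def by linarith
    then have "x < of_nat N" "- of_nat N < x"
      by (simp_all add: abs_less_iff)
    then have "of_rat x < (of_rat (of_nat N) :: real)" "of_rat (- of_nat N) < (of_rat x :: real)"
      by (simp_all only: of_rat_less)
    then have "of_rat x < real N" "- real N < of_rat x"
      by (simp_all add: of_rat_minus)
    then have "\<bar>of_rat x\<bar> < real N"
      by linarith
    then have x2: "(of_rat x)\<^sup>2 \<le> (real N)\<^sup>2"
      by (intro abs_le_square_iff[THEN iffD1]) auto
    define R where "R = sqrt N"
    have R: "R > 0" "R\<^sup>2 = N"
      using \<open>N > 0\<close> by (auto simp: R_def)
    \<comment> \<open>an isometric embedding of the plane spanned by \<open>v0\<close> and \<open>v1\<close> that sends \<open>v0\<close> to \<open>R\<close>\<close>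
    define \<phi> where "\<phi> s t = Complex (of_rat s * R + of_rat t * of_rat x / R)
        (of_rat t * sqrt ((real N)\<^sup>2 - (of_rat x)\<^sup>2) / R)" for s t
    have norm_\<phi>: "(norm (\<phi> s t))\<^sup>2 = of_rat (qform L (s *s v0 + t *s v1))" for s t
    proof -
      have "(norm (\<phi> s t))\<^sup>2 = (of_rat s * R + of_rat t * of_rat x / R)\<^sup>2
          + (of_rat t)\<^sup>2 * ((real N)\<^sup>2 - (of_rat x)\<^sup>2) / R\<^sup>2"
        using x2 by (simp add: \<phi>_def cmod_power2 power_mult_distrib power_divide)
      also have "\<dots> = (of_rat s)\<^sup>2 * R\<^sup>2 + 2 * of_rat s * of_rat t * of_rat x + (of_rat t)\<^sup>2 * R\<^sup>2"
        using R(1) unfolding R(2)[symmetric] by (simp add: field_simps power2_eq_square)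
      also have "\<dots> = of_rat (qform L (s *s v0 + t *s v1))"
        unfolding Qcomb R(2) by (simp add: of_rat_add of_rat_mult of_rat_power)
      finally show ?thesis .
    qed
    define z where "z w = \<phi> (a w) (b w)" for w
    have norm_z: "norm (z w) = R" if "w \<in> W" for w
    proof -
      have "(norm (z w))\<^sup>2 = R\<^sup>2"
        unfolding z_def norm_\<phi> R(2) using ab[OF that] that by (simp add: W)
      then show ?thesis
        using R(1) by (simp add: power2_eq_iff_nonneg)
    qed
    have dist_z: "(norm (z u - z w))\<^sup>2 = of_rat (qform L (u - w))" if "u \<in> W" "w \<in> W" for u w
    proof -
      have "z u - z w = \<phi> (a u - a w) (b u - b w)"
        by (simp add: z_def \<phi>_def complex_eq_iff of_rat_diff algebra_simps diff_divide_distrib)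
      moreover have "u - w = (a u - a w) *s v0 + (b u - b w) *s v1"
        by (subst ab[OF that(1)], subst ab[OF that(2)]) (simp add: vec.scale_left_diff_distrib)
      ultimately show ?thesis
        using norm_\<phi> by simp
    qed
    have "inj_on z W"
    proof (rule inj_onI)
      fix u w assume "u \<in> W" "w \<in> W" "z u = z w"
      then have "qform L (u - w) = 0"
        using dist_z[of u w] by simp
      then show "u = w"
        using ternary_latticeD(2)[OF L, of "u - w"] by fastforce
    qed
    moreover have "card (z ` W) \<le> 2 * n"
    proof (rule card_circle_integral_distances)
      show "(norm (y - y'))\<^sup>2 \<in> \<int>" if y: "y \<in> z ` W" "y' \<in> z ` W" for y y'
      proof -
        obtain u w where uw: "u \<in> W" "w \<in> W" "y = z u" "y' = z w"
          using y by blast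
        then have "qform L (u - w) \<in> \<int>"
          by (intro ternary_latticeD(4)[OF L] lat_closed(3)[OF L]) (auto simp: W)
        then show ?thesis
          using dist_z[of u w] uw by (auto elim!: Ints_cases)
      qed
      have "R ^ 4 = real N ^ 2"
        unfolding R(2)[symmetric] by (simp flip: power_mult)
      then show "(2 * pi) ^ 6 * R ^ 4 < real n ^ 6"
        using n by simp
    qed (use finW R norm_z in auto)
    ultimately show ?thesis
      using card by (simp add: card_image)
  qed
qed

section \<open>Finiteness for bounded Gram matrices\<close>

text \<open>A class is recovered from the value of \<open>f\<close> at any of its members in
  \<open>A\<close>, by choosing some element of \<open>A\<close> with that value.\<close>

lemma finite_quotient_invariant:
  assumes r: "equiv U r" and "A \<subseteq> U" and fin: "finite (f ` A)"
    and f: "\<And>x y. x \<in> A \<Longrightarrow> y \<in> A \<Longrightarrow> f x = f y \<Longrightarrow> (x, y) \<in> r"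
  shows "finite (A // r)"
proof (rule finite_surj[OF fin])
  show "A // r \<subseteq> (\<lambda>y. r `` {SOME x. x \<in> A \<and> f x = y}) ` f ` A"
  proof
    fix X assume "X \<in> A // r"
    then obtain x where x: "x \<in> A" "X = r `` {x}"
      by (auto simp: quotient_def)
    then have "(SOME y. y \<in> A \<and> f y = f x) \<in> A \<and> f (SOME y. y \<in> A \<and> f y = f x) = f x"
      by (intro someI[of "\<lambda>y. y \<in> A \<and> f y = f x"]) auto
    then have "X = r `` {SOME y. y \<in> A \<and> f y = f x}"
      using x f equiv_class_eq[OF r] by metis
    then show "X \<in> (\<lambda>y. r `` {SOME x. x \<in> A \<and> f x = y}) ` f ` A"
      using x by blast
  qed
qed

lemma matrix_columns_mult: "(\<chi> i j. v j $ i) *v c = (\<Sum>j\<in>UNIV. c $ j *s (v j :: 'a::comm_ring_1^'n))"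
  by (simp add: vec_eq_iff matrix_vector_mult_def mult.commute)

text \<open>The isometry carries the frame \<open>v\<close> to the frame \<open>w\<close>. Equal
  Gram matrices make it preserve the forms, and the last hypothesis says that both lattices have the
  same coordinate vectors.\<close>

lemma lattice_isometryI:
  assumes L: "ternary_lattice L" and M: "ternary_lattice M"
    and det: "det (gram L v) \<noteq> 0" and gram: "gram L v = gram M w"
    and lat: "\<And>c. (\<Sum>i\<in>UNIV. c $ i *s v i) \<in> lat L \<longleftrightarrow> (\<Sum>i\<in>UNIV. c $ i *s w i) \<in> lat M"
  shows "\<exists>\<sigma>. lattice_isometry L M \<sigma>"
proof -
  note sbL = ternary_latticeD(1)[OF L] and sbM = ternary_latticeD(1)[OF M]
  define V :: "rat^3^3" where "V = (\<chi> i j. v j $ i)"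
  define W :: "rat^3^3" where "W = (\<chi> i j. w j $ i)"
  have V: "V *v c = (\<Sum>i\<in>UNIV. c $ i *s v i)" and W: "W *v c = (\<Sum>i\<in>UNIV. c $ i *s w i)" for c
    unfolding V_def W_def by (rule matrix_columns_mult)+
  have "det V \<noteq> 0" "det W \<noteq> 0"
    unfolding det_nonzero_iff_ker V W
    using det_gram_nonzeroD[OF sbL det] det_gram_nonzeroD[OF sbM det[unfolded gram]] by blast+
  then have inv: "invertible V" "invertible W"
    by (simp_all add: invertible_det_nz)
  obtain V' W' where V': "V ** V' = mat 1" "V' ** V = mat 1" and W': "W ** W' = mat 1" "W' ** W = mat 1"
    using inv unfolding invertible_def by blast
  define A where "A = W ** V'"
  have surj: "\<exists>c. x = V *v c" for x
    by (rule exI[of _ "V' *v x"]) (simp add: matrix_vector_mul_assoc V')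
  have AV: "A *v (V *v c) = W *v c" for c
    by (simp add: A_def matrix_vector_mul_assoc V' flip: matrix_mul_assoc)
  have "invertible A"
    unfolding A_def using V' by (intro invertible_mult inv(2)) (auto simp: invertible_def)
  have form: "bform L (V *v c) (V *v d) = bform M (W *v c) (W *v d)" for c d
  proof -
    have "bform L (v i) (v j) = bform M (w i) (w j)" for i j
      using gram by (simp add: gram_def vec_eq_iff)
    then show ?thesis
      unfolding V W by (simp add: symmetric_bilinearD(4-7)[OF sbL] symmetric_bilinearD(4-7)[OF sbM])
  qed
  have "lattice_isometry L M ((*v) A)"
    unfolding lattice_isometry_def
  proof (intro conjI allI)
    show "Vector_Spaces.linear (*s) (*s) ((*v) A)"
      by (rule matrix_vector_mul_linear_gen)
    show "bij ((*v) A)"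
      using \<open>invertible A\<close> by (simp add: invertible_eq_bij)
    show "bform M (A *v x) (A *v y) = bform L x y" for x y
      using surj[of x] surj[of y] by (auto simp: AV form)
    have "V *v c \<in> lat L \<longleftrightarrow> W *v c \<in> lat M" for c
      unfolding V W by (rule lat)
    moreover have "\<exists>c. y = W *v c" for y
      by (rule exI[of _ "W' *v y"]) (simp add: matrix_vector_mul_assoc W')
    ultimately show "(*v) A ` lat L = lat M"
      using surj AV by (metis (no_types, opaque_lifting) image_eqI image_subsetI subsetI subset_antisym)
  qed
  then show ?thesis
    by blast
qed

text \<open>Cramer's rule for the integral matrix \<open>2 gram L v\<close>, whose determinant is at most \<open>48 N\<^sup>3\<close>.\<close>

lemma coordinate_denominator:
  assumes L: "ternary_lattice L" and v: "\<And>i. v i \<in> lat L" "\<And>i. qform L (v i) \<le> of_nat N"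
    and det: "det (gram L v) \<noteq> 0" and x: "(\<Sum>i\<in>UNIV. c $ i *s v i) \<in> lat L"
  shows "of_nat (fact (48 * N ^ 3)) * c $ k \<in> \<int>"
proof -
  note sb = ternary_latticeD(1)[OF L]
  let ?x = "\<Sum>i\<in>UNIV. c $ i *s v i"
  define A :: "rat^3^3" where "A = (\<chi> i j. 2 * gram L v $ i $ j)"
  define y :: "rat^3" where "y = (\<chi> i. 2 * bform L (v i) ?x)"
  have detA: "det A = 8 * det (gram L v)"
    unfolding det_3 A_def by simp
  have A_Ints: "A $ i $ j \<in> \<int>" for i j
    unfolding A_def gram_def by (simp add: double_bform_Ints[OF L] v)
  obtain d where d: "det A = of_int d"
    using det_Ints[OF A_Ints] by (auto elim: Ints_cases)
  have "\<bar>det (gram L v)\<bar> \<le> 6 * of_nat N ^ 3"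
    by (rule abs_det_3_le) (simp add: gram_def abs_bform_le[OF L v(2) v(2)])
  then have "(of_int \<bar>d\<bar> :: rat) \<le> of_int (48 * int N ^ 3)"
    using d detA by (simp add: abs_mult)
  then have "nat \<bar>d\<bar> \<le> 48 * N ^ 3"
    by (simp only: of_int_le_iff) (simp add: nat_le_iff)
  moreover have "d \<noteq> 0"
    using d detA det by auto
  \<comment> \<open>The factorial is a multiple of every possible determinant, so one denominator
    serves all lattices with the same \<open>N\<close>.\<close>
  ultimately have "nat \<bar>d\<bar> dvd fact (48 * N ^ 3)"
    by (intro dvd_fact) auto
  then obtain q where q: "int (fact (48 * N ^ 3)) = d * q"
    by (metis dvd_def int_dvd_int_iff abs_dvd_iff nat_0_le abs_ge_zero)
  have "A *v c = y"
    using gram_mult_vector[OF sb, of v c]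
    by (simp add: vec_eq_iff A_def y_def matrix_vector_mult_def mult.assoc flip: sum_distrib_left)
  then have "c = (\<chi> k. det (\<chi> i j. if j = k then y $ i else A $ i $ j) / det A)"
    using cramer[of A c y] d \<open>d \<noteq> 0\<close> by simp
  from arg_cong[OF this, of "\<lambda>c. c $ k"]
  have "c $ k = det (\<chi> i j. if j = k then y $ i else A $ i $ j) / det A"
    by simp
  then have "of_int d * c $ k = det (\<chi> i j. if j = k then y $ i else A $ i $ j)"
    using d \<open>d \<noteq> 0\<close> by simp
  also have "\<dots> \<in> \<int>"
    by (rule det_Ints) (use A_Ints double_bform_Ints[OF L v(1) x] in \<open>simp add: y_def\<close>)
  finally have "of_int q * (of_int d * c $ k) \<in> \<int>"
    by (rule Ints_mult[OF Ints_of_int])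
  then show ?thesis
    using q by (metis mult.assoc mult.commute of_int_mult of_int_of_nat_eq)
qed

text \<open>Here \<open>v\<close> is a basis of the space but may generate a proper sublattice. Its
  Gram matrix fixes the form, and the cosets of its integral span that make up the lattice fix the
  lattice; both data have finitely many values.\<close>

lemma finite_bounded_gram_classes:
  fixes N :: nat
  defines "bounded_basis \<equiv> \<lambda>L v. (\<forall>i::3. v i \<in> lat L \<and> qform L (v i) \<le> of_nat N) \<and> det (gram L v) \<noteq> 0"
  shows "finite ({L. ternary_lattice L \<and> (\<exists>v. bounded_basis L v)} // isometry_rel)"
proof -
  define A where "A = {L. ternary_lattice L \<and> (\<exists>v. bounded_basis L v)}"
  obtain v where v: "\<And>L. L \<in> A \<Longrightarrow> bounded_basis L (v L)"
  proof -
    have "\<forall>L. \<exists>v. L \<in> A \<longrightarrow> bounded_basis L v"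
      unfolding A_def by blast
    from choice[OF this] show ?thesis
      using that by blast
  qed
  define E :: nat where "E = fact (48 * N ^ 3)"
  have "E > 0"
    by (simp add: E_def)
  \<comment> \<open>Doubling makes the entries integers, so bounded entries leave finitely many
    values.\<close>
  define G where "G L i j = 2 * bform L (v L i) (v L j)" for L i j
  \<comment> \<open>All coordinates lie in (1/E) times the integers, so \<open>S L\<close> lists
    representatives of the lattice modulo the integral span of \<open>v L\<close>.\<close>
  define S where "S L = {c :: 3 \<Rightarrow> int. (\<forall>i. c i \<in> {0..<int E}) \<and>
      (\<Sum>i\<in>UNIV. (of_int (c i) / of_nat E) *s v L i) \<in> lat L}" for L
  have fin_fun: "finite {f :: 3 \<Rightarrow> 'b. \<forall>i. f i \<in> B}" if "finite B" for B
  proof -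
    have "{f :: 3 \<Rightarrow> 'b. \<forall>i. f i \<in> B} = PiE UNIV (\<lambda>_. B)"
      by (auto simp: PiE_def)
    then show ?thesis
      using that by (simp add: finite_PiE)
  qed
  show ?thesis
    unfolding A_def[symmetric]
  proof (rule finite_quotient_invariant[OF equiv_isometry_rel, where f = "\<lambda>L. (G L, S L)"])
    show "A \<subseteq> {L. ternary_lattice L}"
      by (auto simp: A_def)
    let ?B = "of_int ` {- 2 * int N..2 * int N} :: rat set"
    let ?GB = "{g :: 3 \<Rightarrow> 3 \<Rightarrow> rat. \<forall>i. g i \<in> {h. \<forall>j. h j \<in> ?B}}"
    let ?SB = "Pow {c :: 3 \<Rightarrow> int. \<forall>i. c i \<in> {0..<int E}}"
    have "G L i j \<in> ?B" if "L \<in> A" for L i j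
    proof -
      have L: "ternary_lattice L" and vL: "\<And>i. v L i \<in> lat L" "\<And>i. qform L (v L i) \<le> of_nat N"
        using that v[OF that] by (auto simp: A_def bounded_basis_def)
      obtain k where k: "G L i j = of_int k"
        using double_bform_Ints[OF L vL(1) vL(1), of i j] unfolding G_def by (elim Ints_cases)
      have "\<bar>G L i j\<bar> \<le> 2 * of_nat N"
        using abs_bform_le[OF L vL(2) vL(2), of i j] by (simp add: G_def abs_mult)
      then have "of_int \<bar>k\<bar> \<le> (of_int (2 * int N) :: rat)"
        by (simp add: k)
      then have "\<bar>k\<bar> \<le> 2 * int N"
        by (simp only: of_int_le_iff)
      then show ?thesis
        by (intro image_eqI[of _ _ k]) (auto simp: k)
    qed
    then have "(\<lambda>L. (G L, S L)) ` A \<subseteq> ?GB \<times> ?SB"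
      by (auto simp: S_def)
    moreover have "finite (?GB \<times> ?SB)"
      by (intro finite_cartesian_product fin_fun finite_Pow_iff[THEN iffD2]) auto
    ultimately show "finite ((\<lambda>L. (G L, S L)) ` A)"
      by (rule finite_subset)
    \<comment> \<open>Division with remainder by \<open>E\<close> splits off an integral combination
      of the frame, which lies in either lattice; the remaining numerators are recorded by
      \<open>S\<close>.\<close>
    have transfer: "(\<Sum>i\<in>UNIV. c $ i *s v M i) \<in> lat M"
      if LM: "L \<in> A" "M \<in> A" "S L = S M" and c: "(\<Sum>i\<in>UNIV. c $ i *s v L i) \<in> lat L" for L M c
    proof -
      have L: "ternary_lattice L" and vL: "\<And>i. v L i \<in> lat L" "\<And>i. qform L (v L i) \<le> of_nat N"
        and det: "det (gram L (v L)) \<noteq> 0"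
        and M: "ternary_lattice M" and vM: "\<And>i. v M i \<in> lat M"
        using that v[OF that(1)] v[OF that(2)] by (auto simp: A_def bounded_basis_def)
      have "\<forall>i. \<exists>k. of_nat E * c $ i = of_int k"
        using coordinate_denominator[OF L vL det c] unfolding E_def by (metis Ints_cases)
      then obtain k where k: "\<And>i. of_nat E * c $ i = of_int (k i)"
        by metis
      have split: "c $ i = of_int (k i mod int E) / of_nat E + of_int (k i div int E)" for i
      proof -
        have "of_nat E * c $ i = of_int (k i mod int E + int E * (k i div int E))"
          unfolding k by simp
        then have "of_nat E * c $ i = of_int (k i mod int E) + of_nat E * of_int (k i div int E)"
          unfolding of_int_add of_int_mult by simp
        then show ?thesis
          using \<open>E > 0\<close> by (simp add: field_simps)
      qed
      define r where "r i = k i mod int E" for i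
      have sum_split: "(\<Sum>i\<in>UNIV. c $ i *s u i) = (\<Sum>i\<in>UNIV. (of_int (r i) / of_nat E) *s u i)
          + (\<Sum>i\<in>UNIV. of_int (k i div int E) *s u i)" for u :: "3 \<Rightarrow> rat^3"
        unfolding r_def split by (simp add: vec.scale_left_distrib sum.distrib)
      have "(\<Sum>i\<in>UNIV. (of_int (r i) / of_nat E) *s v L i) =
          (\<Sum>i\<in>UNIV. c $ i *s v L i) - (\<Sum>i\<in>UNIV. of_int (k i div int E) *s v L i)"
        using sum_split by simp
      also have "\<dots> \<in> lat L"
        by (intro lat_closed(3)[OF L] c lat_closed(1)[OF L] vL)
      finally have "r \<in> S L"
        using \<open>E > 0\<close> by (simp add: S_def r_def)
      then have "(\<Sum>i\<in>UNIV. (of_int (r i) / of_nat E) *s v M i) \<in> lat M"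
        unfolding LM(3) by (simp add: S_def)
      then show ?thesis
        unfolding sum_split by (intro lat_closed(2)[OF M] lat_closed(1)[OF M] vM)
    qed
    show "(L, M) \<in> isometry_rel"
      if "L \<in> A" "M \<in> A" "(G L, S L) = (G M, S M)" for L M
    proof -
      have LM: "ternary_lattice L" "ternary_lattice M" and det: "det (gram L (v L)) \<noteq> 0"
        using that v[OF that(1)] by (auto simp: A_def bounded_basis_def)
      have "bform L (v L i) (v L j) = bform M (v M i) (v M j)" for i j
        using that(3) by (simp add: G_def fun_eq_iff)
      then have gram: "gram L (v L) = gram M (v M)"
        by (simp add: gram_def)
      have S: "S L = S M"
        using that(3) by simp
      have "(\<Sum>i\<in>UNIV. c $ i *s v L i) \<in> lat L \<longleftrightarrow> (\<Sum>i\<in>UNIV. c $ i *s v M i) \<in> lat M" for c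
        using transfer[OF that(1,2) S] transfer[OF that(2,1) S[symmetric]] by blast
      then have "\<exists>\<sigma>. lattice_isometry L M \<sigma>"
        by (rule lattice_isometryI[OF LM det gram])
      then show ?thesis
        using LM by (simp add: isometry_rel_def)
    qed
  qed
qed

section \<open>Strongly s-regular lattices\<close>

text \<open>Write m = k l with \<open>k\<close> the largest divisor of m having only bad prime
  factors. Maximality makes \<open>l\<close> coprime to the bad primes, so regularity has r(k^2) as
  a factor of r(m^2), which is nonzero. Minimality of m then forces m = k.\<close>

lemma prime_factors_m_s_subset:
  assumes reg: "strongly_s_regular L"
  shows "m_s L > 0" "rep_num ((m_s L)\<^sup>2) L \<noteq> 0" "prime_factors (m_s L) \<subseteq> bad_primes L"
proof -
  define m where "m = m_s L"
  have "m > 0 \<and> rep_num (m\<^sup>2) L \<noteq> 0"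
    unfolding m_def m_s_def by (rule LeastI_ex) (use reg in \<open>auto simp: strongly_s_regular_def\<close>)
  then show m: "m_s L > 0" "rep_num ((m_s L)\<^sup>2) L \<noteq> 0"
    by (simp_all add: m_def)
  have least: "m \<le> k" if "k > 0" "rep_num (k\<^sup>2) L \<noteq> 0" for k
    unfolding m_def m_s_def using that by (intro Least_le) auto
  define D where "D = {k. k dvd m \<and> prime_factors k \<subseteq> bad_primes L}"
  have "m > 0"
    using m by (simp add: m_def)
  then have "finite D"
    unfolding D_def by (intro finite_subset[OF _ finite_divisors_nat[of m]]) auto
  moreover have "1 \<in> D"
    by (simp add: D_def)
  ultimately have k: "Max D \<in> D" "\<And>j. j \<in> D \<Longrightarrow> j \<le> Max D"
    by (auto intro!: Max_in)
  define k where "k = Max D"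
  obtain l where l: "m = k * l"
    using k(1) by (auto simp: D_def k_def elim: dvdE)
  have pos: "k > 0" "l > 0"
    using \<open>m > 0\<close> l by auto
  have bad_prime: "prime p" if "p \<in> bad_primes L" for p
    using that by (auto simp: bad_primes_def)
  have "coprime l p" if p: "p \<in> bad_primes L" for p
  proof (rule ccontr)
    assume "\<not> coprime l p"
    then have "p dvd l"
      using prime_imp_coprime[OF bad_prime[OF p], of l] by (auto simp: coprime_commute)
    then have "k * p dvd m"
      unfolding l by (rule mult_dvd_mono[OF dvd_refl])
    moreover have "prime_factors (k * p) \<subseteq> bad_primes L"
    proof
      fix q assume "q \<in> prime_factors (k * p)"
      then have "prime q" "q dvd k * p"
        by auto
      then have q: "prime q" "q dvd k \<or> q dvd p"
        using prime_dvd_multD by blast+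
      show "q \<in> bad_primes L"
      proof (cases "q dvd k")
        case True
        then have "q \<in> prime_factors k"
          using q(1) pos(1) by (simp add: in_prime_factors_iff)
        then show ?thesis
          using k(1) unfolding D_def k_def by blast
      next
        case False
        then show ?thesis
          using q p primes_dvd_imp_eq[OF q(1) bad_prime[OF p]] by simp
      qed
    qed
    ultimately have "k * p \<in> D"
      unfolding D_def by simp
    then show False
      using k(2)[of "k * p"] pos prime_gt_1_nat[OF bad_prime[OF p]] by (simp add: k_def)
  qed
  moreover have "prime_factors k \<subseteq> bad_primes L"
    using k(1) by (simp add: D_def k_def)
  ultimately have "int (rep_num (k\<^sup>2 * l\<^sup>2) L) = int (rep_num (k\<^sup>2) L) *
      (\<Prod>p\<in>{p. prime p \<and> p \<notin> bad_primes L \<and> p dvd m}. h_factor L p (multiplicity p m))"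
    using reg l \<open>m > 0\<close> unfolding strongly_s_regular_def by blast
  moreover have "rep_num (k\<^sup>2 * l\<^sup>2) L \<noteq> 0"
    using m(2) l by (simp add: m_def power_mult_distrib)
  ultimately have "rep_num (k\<^sup>2) L \<noteq> 0"
    by (intro notI) simp
  then have "m \<le> k"
    using pos by (intro least)
  then have "m = k"
    using l pos by simp
  then show "prime_factors (m_s L) \<subseteq> bad_primes L"
    using k(1) by (simp add: D_def k_def m_def)
qed

text \<open>Representations come in pairs \<open>x\<close>, \<open>- x\<close>.\<close>

lemma two_le_rep_num:
  assumes L: "ternary_lattice L" and n: "n > 0" "rep_num n L \<noteq> 0"
  shows "rep_num n L \<ge> 2"
proof -
  define X where "X = {x \<in> lat L. qform L x = of_nat n}"
  have "card X \<noteq> 0"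
    using n by (simp add: rep_num_def X_def)
  then have "finite X" and "X \<noteq> {}"
    by (auto intro: card_ge_0_finite)
  then obtain x where x: "x \<in> X"
    by blast
  have "qform L 0 = 0"
    using symmetric_bilinearD(4)[OF ternary_latticeD(1)[OF L], of 0 0 0] by (simp add: qform_def)
  then have "x \<noteq> 0"
    using x n by (auto simp: X_def)
  then have "x \<noteq> - x"
    by (auto simp: vec_eq_iff)
  moreover have "{x, - x} \<subseteq> X"
    using x lat_closed(4)[OF L] qform_add(3)[OF ternary_latticeD(1)[OF L]] by (auto simp: X_def)
  ultimately show ?thesis
    using card_mono[OF \<open>finite X\<close>, of "{x, - x}"] by (simp add: rep_num_def X_def)
qed

text \<open>All primes of m are bad, so the product has the single factor h_p(1) = p + 1 - Legendre
  symbol, which is at least p; the other factor r(m^2) is at least 2.\<close>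

lemma rep_num_prime_square_ge:
  assumes L: "ternary_lattice L" and reg: "strongly_s_regular L"
    and p: "prime p" "p \<notin> bad_primes L"
  shows "rep_num ((m_s L)\<^sup>2 * p\<^sup>2) L \<ge> 2 * p"
proof -
  define m where "m = m_s L"
  note ms = prime_factors_m_s_subset[OF reg, folded m_def]
  have bad: "q \<in> bad_primes L" if "prime q" "q dvd m" for q
    using that ms(1) subsetD[OF ms(3), of q] by (simp add: in_prime_factors_iff)
  then have ndvd: "\<not> p dvd m"
    using p by blast
  have "coprime p q" if "q \<in> bad_primes L" for q
  proof (rule primes_coprime)
    show "prime q"
      using that by (auto simp: bad_primes_def)
  qed (use p that in auto)
  then have "int (rep_num (m\<^sup>2 * p\<^sup>2) L) = int (rep_num (m\<^sup>2) L) *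
      (\<Prod>q\<in>{q. prime q \<and> q \<notin> bad_primes L \<and> q dvd m * p}. h_factor L q (multiplicity q (m * p)))"
    using reg ms p prime_gt_0_nat[OF p(1)] unfolding strongly_s_regular_def by simp
  also have "{q. prime q \<and> q \<notin> bad_primes L \<and> q dvd m * p} = {p}"
    using bad p by (auto simp: prime_dvd_mult_iff dest: primes_dvd_imp_eq)
  also have "(\<Prod>q\<in>{p}. h_factor L q (multiplicity q (m * p))) = h_factor L p 1"
  proof -
    have "multiplicity p (m * p) = 1"
      using ndvd ms(1) p(1) prime_gt_0_nat[OF p(1)]
      by (subst prime_elem_multiplicity_mult_distrib) (auto simp: not_dvd_imp_multiplicity_0)
    then show ?thesis
      by simp
  qed
  also have "h_factor L p 1 = int p + 1 - Legendre (- disc4 L) (int p)"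
  proof -
    have "(int p ^ (1 + 1) - 1) = (int p + 1) * (int p - 1)"
      by (simp add: algebra_simps power2_eq_square)
    moreover have "int p - 1 \<noteq> 0"
      using prime_gt_1_nat[OF p(1)] by simp
    ultimately show ?thesis
      by (simp add: h_factor_def)
  qed
  finally have "int (rep_num (m\<^sup>2 * p\<^sup>2) L) =
      int (rep_num (m\<^sup>2) L) * (int p + 1 - Legendre (- disc4 L) (int p))" .
  moreover have "Legendre (- disc4 L) (int p) \<le> 1"
    by (simp add: Legendre_def)
  ultimately have "2 * int p \<le> int (rep_num (m\<^sup>2 * p\<^sup>2) L)"
    using two_le_rep_num[OF L, of "m\<^sup>2"] ms by (simp add: mult_mono)
  then show ?thesis
    by (simp add: m_def)
qed

text \<open>This is the condition of \<open>independent_triple\<close> for \<open>p - 1\<close> arcs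
  on a circle of radius m p. The constants come from 4 pi <= 13, 13^3 = 2197 and p <= 2(p -
  1).\<close>

lemma arc_count_bound:
  fixes m p :: nat
  assumes "p > 2197 * m\<^sup>2" "p \<ge> 2"
  shows "(2 * pi) ^ 6 * real (m\<^sup>2 * p\<^sup>2) ^ 2 < real (p - 1) ^ 6"
proof -
  have "(2 * pi) ^ 6 * 64 = (4 * pi) ^ 6"
    by (simp add: power_mult_distrib)
  also have "\<dots> \<le> 13 ^ 6"
    using pi_less_4 pi_approx by (intro power_mono) auto
  finally have "(2 * pi) ^ 6 * 64 * real (m\<^sup>2 * p\<^sup>2) ^ 2 \<le> 13 ^ 6 * real (m\<^sup>2 * p\<^sup>2) ^ 2"
    by (rule mult_right_mono) simp
  also have "\<dots> = real (2197 * m\<^sup>2) ^ 2 * real p ^ 4"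
    by (simp add: power_mult_distrib flip: power_mult)
  also have "\<dots> < real p ^ 2 * real p ^ 4"
  proof (intro mult_strict_right_mono power_strict_mono)
    show "real (2197 * m\<^sup>2) < real p"
      using assms(1) by (simp only: of_nat_less_iff)
  qed (use assms(2) in auto)
  also have "\<dots> = real p ^ 6"
    by (simp flip: power_add)
  also have "\<dots> \<le> (2 * real (p - 1)) ^ 6"
    using assms by (intro power_mono) auto
  also have "\<dots> = real (p - 1) ^ 6 * 64"
    by (simp add: power_mult_distrib)
  finally show ?thesis
    by simp
qed

theorem theorem2p9:
  fixes m :: nat
  assumes "m > 0"
  shows "finite ({L. ternary_lattice L \<and> strongly_s_regular L \<and> m_s L = m} // isometry_rel)"
proof -
  \<comment> \<open>\<open>M\<close> depends on \<open>m\<close> alone, since the quantification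
    over \<open>d\<close> is inside.\<close>
  obtain M where M: "\<And>d. d > 0 \<Longrightarrow>
      (\<And>p. prime p \<Longrightarrow> p > 2197 * m\<^sup>2 \<Longrightarrow> \<not> p dvd d \<Longrightarrow> d \<le> 24 * m ^ 6 * p ^ 6) \<Longrightarrow>
      \<exists>p. prime p \<and> p > 2197 * m\<^sup>2 \<and> \<not> p dvd d \<and> p \<le> M"
    using small_prime_not_dvd[of "2197 * m\<^sup>2" "24 * m ^ 6"] by blast
  define N where "N = m\<^sup>2 * M\<^sup>2"
  define bounded where "bounded = {L. ternary_lattice L \<and>
      (\<exists>v. (\<forall>i::3. v i \<in> lat L \<and> qform L (v i) \<le> of_nat N) \<and> det (gram L v) \<noteq> 0)}"
  have "{L. ternary_lattice L \<and> strongly_s_regular L \<and> m_s L = m} \<subseteq> bounded"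
  proof clarify
    fix L assume L: "ternary_lattice L" and reg: "strongly_s_regular L" and m: "m = m_s L"
    define d where "d = nat \<bar>disc4 L\<bar>"
    have triple: "\<exists>v. (\<forall>i. v i \<in> lat L \<and> qform L (v i) = of_nat (m\<^sup>2 * p\<^sup>2)) \<and> det (gram L v) \<noteq> 0"
      if p: "prime p" "p > 2197 * m\<^sup>2" "\<not> p dvd d" for p
    proof -
      \<comment> \<open>The prime 2 always belongs to \<open>bad_primes L\<close>, so it has to be
        excluded by size.\<close>
      have "p \<noteq> 2"
        using p(2) \<open>m > 0\<close> by (cases m) (auto simp: power2_eq_square)
      then have "p \<notin> bad_primes L"
        using p(3) by (auto simp: bad_primes_def d_def)
      then have "2 * p \<le> card {x \<in> lat L. qform L x = of_nat (m\<^sup>2 * p\<^sup>2)}"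
        using rep_num_prime_square_ge[OF L reg p(1)] by (simp add: m rep_num_def)
      \<comment> \<open>Taking \<open>p - 1\<close> arcs rather than \<open>p\<close> makes the
        inequality strict.\<close>
      then have many: "2 * (p - 1) < card {x \<in> lat L. qform L x = of_nat (m\<^sup>2 * p\<^sup>2)}"
        using prime_gt_0_nat[OF p(1)] by linarith
      show ?thesis
        using independent_triple[OF L refl many arc_count_bound[OF p(2) prime_ge_2_nat[OF p(1)]]]
        by simp
    qed
    have "d > 0"
      using disc_nonzero[OF L] disc4_eq[OF L] by (auto simp: d_def)
    moreover have "d \<le> 24 * m ^ 6 * p ^ 6" if p: "prime p" "p > 2197 * m\<^sup>2" "\<not> p dvd d" for p
    proof -
      obtain v where v: "\<And>i. v i \<in> lat L" "\<And>i. qform L (v i) = of_nat (m\<^sup>2 * p\<^sup>2)"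
        and det: "det (gram L v) \<noteq> 0"
        using triple[OF p] by blast
      have "(of_nat d :: rat) = of_int \<bar>disc4 L\<bar>"
        by (simp add: d_def)
      also have "\<dots> \<le> 24 * of_nat (m\<^sup>2 * p\<^sup>2) ^ 3"
        by (rule abs_disc4_le[OF L v(1) _ det]) (simp add: v(2))
      also have "\<dots> = of_nat (24 * m ^ 6 * p ^ 6)"
        by (simp add: power_mult_distrib flip: power_mult)
      finally show ?thesis
        by (simp only: of_nat_le_iff)
    qed
    \<comment> \<open>The discriminant bound at every good prime yields one good prime below
      \<open>M\<close>; the triple belonging to it has length bounded in terms of
      \<open>m\<close>.\<close>
    ultimately obtain p where p: "prime p" "p > 2197 * m\<^sup>2" "\<not> p dvd d" "p \<le> M"
      using M by blast
    then obtain v where v: "\<And>i. v i \<in> lat L" "\<And>i. qform L (v i) = of_nat (m\<^sup>2 * p\<^sup>2)"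
      and det: "det (gram L v) \<noteq> 0"
      using triple by blast
    have "m\<^sup>2 * p\<^sup>2 \<le> N"
      unfolding N_def using p(4) by (intro mult_le_mono power_mono) auto
    then have "qform L (v i) \<le> of_nat N" for i
      unfolding v(2) by (simp only: of_nat_le_iff)
    then show "L \<in> bounded"
      unfolding bounded_def using L v(1) det by blast
  qed
  then have "{L. ternary_lattice L \<and> strongly_s_regular L \<and> m_s L = m} // isometry_rel
      \<subseteq> bounded // isometry_rel"
    by (auto simp: quotient_def)
  moreover have "finite (bounded // isometry_rel)"
    unfolding bounded_def by (rule finite_bounded_gram_classes)
  ultimately show ?thesis
    by (rule finite_subset)
qed

end
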